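(* Let $\alpha,\beta\in\,]0,1[$ be fixed. Then the test $\Psi_{3,\alpha}$ defined in the context is of level $\alpha$. Moreover, if $n\ge3$ and $$8.25\times\frac{\ln\big[4d\log_2(n/2)/\alpha\big]}{n}\ \le\ \int_M^{+\infty}\phi_1(x)\,dx,$$ then there exists a positive constant $C(\beta,M)$, depending only on $\beta$ and $M$, such that $$\sup_{f_{(\varepsilon,\mu)}\in\mathcal F_\infty[M],\ \varepsilon\|\mu\|_\infty\ge\rho}\ \mathbb{P}_{f_{(\varepsilon,\mu)}}(\Psi_{3,\alpha}=0)\le\beta$$ as soon as $$\rho\ \ge\ C(\beta,M)\times\sqrt{\frac{\ln\ln(n)\,\ln(d/\alpha)}{n}} .$$
   Context: Let $M>0$ be given. Let $\phi_d$ be the density of the standard Gaussian distribution $\mathcal N_d(0_d,I_d)$ on $\mathbb{R}^d$ (so $\phi_1$ is the standard normal density on $\mathbb{R}$). For $\varepsilon\in\,]0,1[$ and $\mu\in\mathbb{R}^d$ put $f_{(\varepsilon,\mu)}(x)=(1-\varepsilon)\phi_d(x)+\varepsilon\phi_d(x-\mu)$. Let $\|\mu\|_\infty=\max_{1\le j\le d}|\mu_j|$ and $\mathcal F_\infty[M]=\{f_{(\varepsilon,\mu)}:\varepsilon\in\,]0,1[,\ \|\mu\|_\infty\le M\}$. One observes an i.i.d. sample $(X_1,\dots,X_n)$, $n\ge2$, of $\mathbb{R}^d$-valued random vectors. For a density $g$ on $\mathbb{R}^d$, $\mathbb{P}_g$ is the probability when the common density of the $X_i$ is $g$; $\mathbb{P}_0:=\mathbb{P}_{\phi_d}$.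 A test $\Psi$ (a measurable $\{0,1\}$-valued function of the sample) has level $\alpha$ if $\mathbb{P}_0(\Psi=1)\le\alpha$. Definition of $\Psi_{3,\alpha}$. Let $\mathcal K_n=\{2^j:\ 0\le j\le\lfloor\log_2(n/2)\rfloor\}$. Let $Z_{(1)}\le\dots\le Z_{(n)}$ be the order statistics of $n$ i.i.d. standard real Gaussian variables; for $u\in\,]0,1[$ let $q_{u,k}$ be the $(1-u)$-quantile of $Z_{(n-k+1)}$, and for $a\in\,]0,1[$ let $$a_n=\sup\{u\in\,]0,1[:\ \mathbb{P}(\exists k\in\mathcal K_n,\ Z_{(n-k+1)}>q_{u,k})\le a\}.$$ With $(e_1,\dots,e_d)$ the canonical basis of $\mathbb{R}^d$, let $Z_{i,j}=\langle X_i,e_j\rangle$ and, for each $j$, let $Z_{(1),j}\le\dots\le Z_{(n),j}$ be the order statistics of $(Z_{i,j})_{1\le i\le n}$. For $a\in\,]0,1[$ put $$T^+_{a,j}=\sup_{k\in\mathcal K_n}\mathbf{1}_{\{Z_{(n-k+1),j}>q_{a_n,k}\}},\qquad T^-_{a,j}=\sup_{k\in\mathcal K_n}\mathbf{1}_{\{Z_{(k),j}<-q_{a_n,k}\}}.$$ Then $$\Psi_{3,\alpha}=\sup_{1\le j\le d}\max\big(T^+_{\alpha/(2d),j},\,T^-_{\alpha/(2d),j}\big).$$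
   Formalization: The constant C may also depend on a bound η<1 with α/d ≤ η (η arbitrary): for d=1 and α→1 the rate tends to 0 and no C(β,M) works for small β. With η=1/2, C depends only on β, M for all d≥2, and for d=1, α≤1/2; with η=α every fixed α is covered. *)

theory Defs
  imports "HOL-Probability.Probability"
begin

text \<open>
  The constant in the separation rate must not depend on the dimension \<open>d\<close>, so \<open>d\<close> has to be
  quantified inside the statement.  Vectors of dimension \<open>d\<close> are therefore functions
  \<open>nat \<Rightarrow> real\<close> used on the index set \<open>{1..d}\<close>, and a sample is \<open>x :: nat \<Rightarrow> nat \<Rightarrow> real\<close>,
  where \<open>x i j\<close> is coordinate \<open>j\<close> of observation \<open>i\<close>, for \<open>i \<in> {1..n}\<close>.
\<close>

definition std_gauss_density :: "nat \<Rightarrow> (nat \<Rightarrow> real) \<Rightarrow> real" where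
  "std_gauss_density d x = (\<Prod>j\<in>{1..d}. std_normal_density (x j))"

definition mixture_density :: "nat \<Rightarrow> real \<Rightarrow> (nat \<Rightarrow> real) \<Rightarrow> (nat \<Rightarrow> real) \<Rightarrow> real" where
  "mixture_density d \<epsilon> \<mu> x =
     (1 - \<epsilon>) * std_gauss_density d x + \<epsilon> * std_gauss_density d (\<lambda>j. x j - \<mu> j)"

definition linf_norm :: "nat \<Rightarrow> (nat \<Rightarrow> real) \<Rightarrow> real" where
  "linf_norm d \<mu> = (MAX j\<in>{1..d}. \<bar>\<mu> j\<bar>)"

text \<open>The parameters \<open>(\<epsilon>, \<mu>)\<close> of the densities in the alternative class.\<close>

definition mixture_params :: "nat \<Rightarrow> real \<Rightarrow> (real \<times> (nat \<Rightarrow> real)) set" where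
  "mixture_params d M = {(\<epsilon>, \<mu>). \<epsilon> \<in> {0<..<1} \<and> linf_norm d \<mu> \<le> M}"

definition sample_law :: "nat \<Rightarrow> nat \<Rightarrow> ((nat \<Rightarrow> real) \<Rightarrow> real) \<Rightarrow> (nat \<Rightarrow> nat \<Rightarrow> real) measure" where
  "sample_law n d g =
     (\<Pi>\<^sub>M i\<in>{1..n}. density (\<Pi>\<^sub>M j\<in>{1..d}. lborel) (\<lambda>x. ennreal (g x)))"

definition test_of_level ::
    "nat \<Rightarrow> nat \<Rightarrow> ((nat \<Rightarrow> nat \<Rightarrow> real) \<Rightarrow> nat) \<Rightarrow> real \<Rightarrow> bool" where
  "test_of_level n d \<Psi> \<alpha> \<longleftrightarrow>
     \<Psi> \<in> (\<Pi>\<^sub>M i\<in>{1..n}. \<Pi>\<^sub>M j\<in>{1..d}. borel) \<rightarrow>\<^sub>M count_space {0, 1} \<and>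
     \<P>(x in sample_law n d (std_gauss_density d). \<Psi> x = 1) \<le> \<alpha>"

text \<open>The \<open>k\<close>-th smallest of \<open>z 1, \<dots>, z n\<close>, for \<open>1 \<le> k \<le> n\<close>.\<close>

definition order_stat :: "nat \<Rightarrow> (nat \<Rightarrow> real) \<Rightarrow> nat \<Rightarrow> real" where
  "order_stat n z k = sort (map z [1..<Suc n]) ! (k - 1)"

definition dyadic_ranks :: "nat \<Rightarrow> nat set" where
  "dyadic_ranks n = {2 ^ j |j. int j \<le> \<lfloor>log 2 (real n / 2)\<rfloor>}"

definition gauss_sample :: "nat \<Rightarrow> (nat \<Rightarrow> real) measure" where
  "gauss_sample n = (\<Pi>\<^sub>M i\<in>{1..n}. density lborel (\<lambda>x. ennreal (std_normal_density x)))"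

definition quantile :: "real measure \<Rightarrow> real \<Rightarrow> real" where
  "quantile N p = Inf {x. p \<le> cdf N x}"

definition order_quantile :: "nat \<Rightarrow> real \<Rightarrow> nat \<Rightarrow> real" where
  "order_quantile n u k =
     quantile (distr (gauss_sample n) borel (\<lambda>z. order_stat n z (n - k + 1))) (1 - u)"

definition calibrated_level :: "nat \<Rightarrow> real \<Rightarrow> real" where
  "calibrated_level n a = Sup {u \<in> {0<..<1}.
     \<P>(z in gauss_sample n.
        \<exists>k\<in>dyadic_ranks n. order_stat n z (n - k + 1) > order_quantile n u k) \<le> a}"

definition T_plus :: "nat \<Rightarrow> real \<Rightarrow> (nat \<Rightarrow> real) \<Rightarrow> nat" where
  "T_plus n a z = (MAX k\<in>dyadic_ranks n.
     of_bool (order_stat n z (n - k + 1) > order_quantile n (calibrated_level n a) k))"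

definition T_minus :: "nat \<Rightarrow> real \<Rightarrow> (nat \<Rightarrow> real) \<Rightarrow> nat" where
  "T_minus n a z = (MAX k\<in>dyadic_ranks n.
     of_bool (order_stat n z k < - order_quantile n (calibrated_level n a) k))"

definition Psi3 :: "nat \<Rightarrow> nat \<Rightarrow> real \<Rightarrow> (nat \<Rightarrow> nat \<Rightarrow> real) \<Rightarrow> nat" where
  "Psi3 n d \<alpha> x = (MAX j\<in>{1..d}.
     max (T_plus n (\<alpha> / (2 * real d)) (\<lambda>i. x i j))
         (T_minus n (\<alpha> / (2 * real d)) (\<lambda>i. x i j)))"

text \<open>The supremum is taken in \<^typ>\<open>ennreal\<close>, so that it is \<open>0\<close> over an empty class.\<close>

definition max_type2_error ::
    "nat \<Rightarrow> nat \<Rightarrow> real \<Rightarrow> real \<Rightarrow> ((nat \<Rightarrow> nat \<Rightarrow> real) \<Rightarrow> nat) \<Rightarrow> ennreal" where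
  "max_type2_error n d M \<rho> \<Psi> =
     (SUP (\<epsilon>, \<mu>)\<in>{(\<epsilon>, \<mu>) \<in> mixture_params d M. \<rho> \<le> \<epsilon> * linf_norm d \<mu>}.
        ennreal (\<P>(x in sample_law n d (mixture_density d \<epsilon> \<mu>). \<Psi> x = 0)))"

text \<open>
  The rate \<open>sqrt (ln (ln n) * ln (d / \<alpha>) / n)\<close> vanishes as \<open>\<alpha> / d\<close> tends to \<open>1\<close>, which is only
  possible for \<open>d = 1\<close> and \<open>\<alpha>\<close> tending to \<open>1\<close>, whereas for fixed \<open>n\<close> the second kind error of the test near
  the null hypothesis stays bounded away from \<open>0\<close>.  Hence, for small \<open>\<beta>\<close>, no constant is valid
  for \<open>d = 1\<close> and all levels \<open>\<alpha> < 1\<close> at once.  The theorem takes the constant uniform over all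
  \<open>(\<alpha>, d)\<close> with \<open>\<alpha> / d \<le> \<eta>\<close>, for an arbitrary \<open>\<eta> < 1\<close>: with \<open>\<eta> = 1/2\<close> this covers every
  level and every \<open>d \<ge> 2\<close>, and with \<open>\<eta> = \<alpha>\<close> a fixed level \<open>\<alpha>\<close> and every \<open>d \<ge> 1\<close>.
\<close>

end

theory Submission
  imports Defs
begin

text \<open>
  Everything is one-dimensional. Coordinate \<open>j\<close> of an observation, multiplied by a sign \<open>s\<close>, follows
  the two-point location mixture \<open>(1 - \<epsilon>) N(0, 1) + \<epsilon> N(s \<mu>\<^sub>j, 1)\<close> (\<open>distr_mixture_vector_law\<close>), and
  \<open>T_minus\<close> of a sample is \<open>T_plus\<close> of the reflected sample. So the test rejects iff \<open>T_plus\<close> rejects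
  one of the \<open>2 d\<close> signed coordinate samples, each of which is a standard Gaussian sample under the
  null hypothesis.

  Level. For a Gaussian sample the distribution function \<open>F\<^sub>k\<close> of the \<open>k\<close>-th largest value is continuous
  and strictly increasing, hence the \<open>k\<close>-th largest value exceeds its quantile \<open>q\<^bsub>u,k\<^esub>\<close> iff \<open>1 - F\<^sub>k\<close> at it
  is less than \<open>u\<close>. The family of events whose probability defines the calibrated level is therefore
  increasing and left continuous in \<open>u\<close>, so that the supremum is attained
  (\<open>calibrated_level_sound\<close>), and a union bound over the \<open>2 d\<close> signed coordinates gives level \<open>\<alpha>\<close>.
  A union bound over the ranks also shows that the calibrated level of \<open>a\<close> is at least \<open>a\<close> divided by
  the number of ranks (\<open>calibrated_level_bounds\<close>).

  Power. Take the coordinate carrying the largest \<open>\<bar>\<mu>\<^sub>j\<bar> = h\<close>, with the sign making it nonnegative, and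
  a single dyadic rank \<open>k\<close> with \<open>n/4 < k \<le> n/2\<close>. The \<open>k\<close>-th largest value exceeds \<open>t\<close> iff at least \<open>k\<close>
  sample points do, so Hoeffding's inequality for the number of points above \<open>t\<close> controls both errors.
  Put \<open>L = ln (2 d K / \<alpha>)\<close>, where \<open>K\<close> is the number of ranks. If the Gaussian tail at \<open>t\<close> equals
  \<open>p = k/n - sqrt (L / (2 n))\<close>, then \<open>t\<close> is above the critical quantile; if moreover the mixture tail at
  \<open>t\<close> is at least \<open>k/n + sqrt (ln (1/\<beta>) / (2 n))\<close>, then rank \<open>k\<close> rejects with probability at least
  \<open>1 - \<beta>\<close> (\<open>T_plus_type2_error\<close>). As a Gaussian tail is at most \<open>1\<close>, the hypothesis with the factor
  \<open>8.25\<close> gives \<open>L / (2 n) \<le> 2/33 < 1/16\<close>, which keeps \<open>p\<close> in a fixed compact subinterval of \<open>]0, 1[\<close>, hence \<open>t\<close> in a fixed compact interval.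
  There the Gaussian density is bounded below, so that moving a fraction \<open>\<epsilon>\<close> of the mass by
  \<open>h \<le> M\<close> raises the tail by at least \<open>c \<epsilon> h\<close>, with \<open>c\<close> depending on \<open>M\<close> only
  (\<open>ex_separating_threshold\<close>). It remains to have \<open>c \<epsilon> h \<ge> sqrt (L / (2 n)) + sqrt (ln (1/\<beta>) / (2 n))\<close>,
  and both terms are at most a constant times \<open>sqrt (ln (ln n) ln (d/\<alpha>) / n)\<close>: \<open>L\<close> is at most
  the sum of the two logarithms plus a constant, and a sum of two quantities bounded away from \<open>0\<close> is at most a
  constant times their product (\<open>log_level_le_rate\<close>).
\<close>

section \<open>Order statistics and exceedance counts\<close>

lemma sorted_nth_downward_iff:
  fixes xs :: "'a :: linorder list"
  assumes "sorted xs" "m < length xs"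
    and down: "\<And>x y. x \<le> y \<Longrightarrow> P y \<Longrightarrow> P x"
  shows "P (xs ! m) \<longleftrightarrow> m < length (filter P xs)"
proof
  assume "P (xs ! m)"
  then have "{..m} \<subseteq> {i. i < length xs \<and> P (xs ! i)}"
    using assms(2) by (auto intro: down sorted_nth_mono[OF assms(1)])
  from card_mono[OF _ this] show "m < length (filter P xs)"
    by (simp add: length_filter_conv_card)
next
  assume less: "m < length (filter P xs)"
  show "P (xs ! m)"
  proof (rule ccontr)
    assume neg: "\<not> P (xs ! m)"
    have "{i. i < length xs \<and> P (xs ! i)} \<subseteq> {..<m}"
    proof
      fix i assume "i \<in> {i. i < length xs \<and> P (xs ! i)}"
      then have "\<not> xs ! m \<le> xs ! i" "i < length xs"
        using neg down by auto
      then have "\<not> m \<le> i" using sorted_nth_mono[OF assms(1)] by blast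
      then show "i \<in> {..<m}" by simp
    qed
    from card_mono[OF _ this] less show False
      by (simp add: length_filter_conv_card)
  qed
qed

text \<open>
  The predicates \<open>\<lambda>y. y \<le> t\<close> and \<open>\<lambda>y. y < t\<close> are both closed under passing to smaller values; this
  common form turns every comparison of an order statistic with a level into a count of sample
  points.
\<close>

lemma order_stat_downward_iff:
  assumes k: "1 \<le> k" "k \<le> n"
    and down: "\<And>x y. x \<le> y \<Longrightarrow> P y \<Longrightarrow> P x"
  shows "P (order_stat n z k) \<longleftrightarrow> k \<le> card {i \<in> {1..n}. P (z i)}"
proof -
  let ?xs = "map z [1..<Suc n]"
  have "P (order_stat n z k) \<longleftrightarrow> k - 1 < length (filter P (sort ?xs))"
    unfolding order_stat_def by (rule sorted_nth_downward_iff) (use k down in auto)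
  also have "length (filter P (sort ?xs)) = size (filter_mset P (mset ?xs))"
    by (metis mset_filter mset_sort size_mset)
  also have "\<dots> = length (filter P ?xs)"
    by (metis mset_filter size_mset)
  also have "\<dots> = card (set (filter (P \<circ> z) [1..<Suc n]))"
    by (subst distinct_card) (auto simp del: upt_Suc simp: filter_map)
  also have "set (filter (P \<circ> z) [1..<Suc n]) = {i \<in> {1..n}. P (z i)}"
    by (auto simp: less_Suc_eq_le simp del: upt_Suc)
  finally show ?thesis using k by linarith
qed

lemma order_stat_greater_iff:
  assumes "1 \<le> k" "k \<le> n"
  shows "t < order_stat n z (n - k + 1) \<longleftrightarrow> k \<le> card {i \<in> {1..n}. t < z i}"
proof -
  have "{i \<in> {1..n}. t < z i} \<union> {i \<in> {1..n}. z i \<le> t} = {1..n}" by auto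
  moreover have "card ({i \<in> {1..n}. t < z i} \<union> {i \<in> {1..n}. z i \<le> t})
    = card {i \<in> {1..n}. t < z i} + card {i \<in> {1..n}. z i \<le> t}"
    by (rule card_Un_disjoint) auto
  ultimately have "card {i \<in> {1..n}. t < z i} + card {i \<in> {1..n}. z i \<le> t} = n"
    by simp
  moreover have "order_stat n z (n - k + 1) \<le> t \<longleftrightarrow> n - k + 1 \<le> card {i \<in> {1..n}. z i \<le> t}"
    by (rule order_stat_downward_iff) (use assms in auto)
  ultimately show ?thesis using assms by (auto simp: not_le[symmetric])
qed

text \<open>
  Used twice: if all sample points lie in an interval then so does every order statistic, and an order
  statistic can only hit a value that some sample point hits.
\<close>

lemma order_stat_in_sample:
  assumes "1 \<le> k" "k \<le> n"
  obtains i where "i \<in> {1..n}" "order_stat n z k = z i"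
proof -
  have "order_stat n z k \<in> set (sort (map z [1..<Suc n]))"
    unfolding order_stat_def by (rule nth_mem) (use assms in auto)
  then obtain i where "i \<in> set [1..<Suc n]" "order_stat n z k = z i"
    by (auto simp del: upt_Suc)
  then show thesis by (intro that[of i]) (auto simp: less_Suc_eq_le)
qed

lemma order_stat_cong:
  assumes "\<And>i. i \<in> {1..n} \<Longrightarrow> z i = w i"
  shows "order_stat n z k = order_stat n w k"
proof -
  have "map z [1..<Suc n] = map w [1..<Suc n]"
    by (rule map_cong) (use assms in auto)
  then show ?thesis unfolding order_stat_def by (simp only:)
qed

lemma measurable_hit_count:
  fixes n :: nat
  assumes f [measurable]: "\<And>i. i \<in> {1..n} \<Longrightarrow> (\<lambda>x. f x i) \<in> M \<rightarrow>\<^sub>M N"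
    and A [measurable]: "A \<in> sets N"
  shows "(\<lambda>x. card {i \<in> {1..n}. f x i \<in> A}) \<in> M \<rightarrow>\<^sub>M count_space UNIV"
proof (rule measurable_card)
  fix i
  show "{x \<in> space M. i \<in> {i \<in> {1..n}. f x i \<in> A}} \<in> sets M"
  proof (cases "i \<in> {1..n}")
    case True
    then have "{x \<in> space M. f x i \<in> A} \<in> sets M" by measurable
    with True show ?thesis by simp
  qed simp
qed

lemma borel_measurable_order_stat:
  assumes k: "1 \<le> k" "k \<le> n"
    and meas [measurable]: "\<And>i. i \<in> {1..n} \<Longrightarrow> (\<lambda>x. f x i) \<in> borel_measurable M"
  shows "(\<lambda>x. order_stat n (f x) k) \<in> borel_measurable M"
proof (rule borel_measurableI_less)
  fix t :: real
  have eq: "order_stat n (f x) k < t \<longleftrightarrow> k \<le> card {i. i \<in> {1..n} \<and> f x i < t}" for x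
    using order_stat_downward_iff[OF k, of "\<lambda>y. y < t" "f x"] by simp
  have "(\<lambda>x. card {i \<in> {1..n}. f x i \<in> {..<t}}) \<in> M \<rightarrow>\<^sub>M count_space UNIV"
    by (rule measurable_hit_count[OF meas]) auto
  then have "(\<lambda>x. card {i. i \<in> {1..n} \<and> f x i < t}) \<in> M \<rightarrow>\<^sub>M count_space UNIV"
    by simp
  then have "Measurable.pred M (\<lambda>x. k \<le> card {i. i \<in> {1..n} \<and> f x i < t})"
    by measurable
  then show "{x \<in> space M. order_stat n (f x) k < t} \<in> sets M"
    unfolding eq pred_def .
qed

section \<open>The dyadic ranks\<close>

lemma dyadic_ranks_iff:
  assumes "2 \<le> n"
  shows "k \<in> dyadic_ranks n \<longleftrightarrow> (\<exists>j. k = 2 ^ j \<and> 2 * k \<le> n)"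
proof -
  have "int j \<le> \<lfloor>log 2 (real n / 2)\<rfloor> \<longleftrightarrow> 2 * 2 ^ j \<le> n" for j
  proof -
    have "int j \<le> \<lfloor>log 2 (real n / 2)\<rfloor> \<longleftrightarrow> real j \<le> log 2 (real n / 2)"
      by (simp add: le_floor_iff)
    also have "\<dots> \<longleftrightarrow> 2 powr real j \<le> real n / 2"
      using assms by (simp add: le_log_iff)
    also have "\<dots> \<longleftrightarrow> real (2 * 2 ^ j) \<le> real n"
      by (simp add: powr_realpow field_simps)
    also have "\<dots> \<longleftrightarrow> 2 * 2 ^ j \<le> n" by (rule of_nat_le_iff)
    finally show ?thesis .
  qed
  then show ?thesis unfolding dyadic_ranks_def by auto
qed

lemma dyadic_ranks_bounds:
  assumes "2 \<le> n" "k \<in> dyadic_ranks n"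
  shows "1 \<le> k" "2 * k \<le> n" "k \<le> n"
  using assms by (auto simp: dyadic_ranks_iff)

lemma finite_dyadic_ranks: "2 \<le> n \<Longrightarrow> finite (dyadic_ranks n)"
  by (rule finite_subset[of _ "{..n}"]) (auto dest: dyadic_ranks_bounds)

lemma one_in_dyadic_ranks: "2 \<le> n \<Longrightarrow> 1 \<in> dyadic_ranks n"
  by (auto simp: dyadic_ranks_iff intro: exI[of _ 0])

lemma dyadic_ranks_nonempty: "2 \<le> n \<Longrightarrow> dyadic_ranks n \<noteq> {}"
  using one_in_dyadic_ranks by blast

lemma card_dyadic_ranks_pos: "2 \<le> n \<Longrightarrow> 0 < card (dyadic_ranks n)"
  by (simp add: card_gt_0_iff finite_dyadic_ranks dyadic_ranks_nonempty)

lemma card_dyadic_ranks_le: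
  assumes "2 \<le> n"
  shows "real (card (dyadic_ranks n)) \<le> log 2 (real n)"
proof -
  let ?m = "nat \<lfloor>log 2 (real n / 2)\<rfloor>"
  have nonneg: "0 \<le> log 2 (real n / 2)" using assms by simp
  have "dyadic_ranks n \<subseteq> (\<lambda>j. 2 ^ j) ` {..?m}"
    unfolding dyadic_ranks_def by (auto simp: le_nat_iff intro!: imageI)
  then have "card (dyadic_ranks n) \<le> card {..?m}"
    by (meson card_image_le card_mono finite_atMost finite_imageI le_trans)
  then have "real (card (dyadic_ranks n)) \<le> 1 + real ?m" by simp
  also have "real ?m \<le> log 2 (real n / 2)" using nonneg by simp
  also have "1 + log 2 (real n / 2) = log 2 (real n)"
    using assms by (simp add: log_divide)
  finally show ?thesis by simp
qed

text \<open>
  The number of ranks is \<open>\<lfloor>log 2 n\<rfloor>\<close>, while the sample size condition is phrased with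
  \<open>log 2 (n/2)\<close>, which can be smaller. A factor \<open>2\<close> absorbs the difference: it suffices for \<open>n \<ge> 4\<close>
  because then \<open>log 2 n \<ge> 2\<close>, and for \<open>n = 3\<close> because there is a single rank and \<open>(3/2)\<^sup>2 \<ge> 2\<close>.
\<close>

lemma card_dyadic_ranks_le_twice_log:
  assumes "3 \<le> n"
  shows "real (card (dyadic_ranks n)) \<le> 2 * log 2 (real n / 2)"
proof (cases "n = 3")
  case True
  have "dyadic_ranks n \<subseteq> {1}"
    using dyadic_ranks_bounds[of n] True by (auto intro: le_antisym) force
  then have "card (dyadic_ranks n) \<le> card {1::nat}" by (intro card_mono) auto
  moreover have "1 \<le> 2 * log 2 (real n / 2)"
  proof -
    have "log 2 2 \<le> log 2 ((real n / 2) ^ 2)"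
      using True by (subst log_le_cancel_iff) (auto simp: power2_eq_square)
    also have "\<dots> = 2 * log 2 (real n / 2)" using True by (subst log_nat_power) auto
    finally show ?thesis by simp
  qed
  ultimately show ?thesis by simp
next
  case False
  with assms have n: "4 \<le> n" by simp
  have "2 \<le> log 2 (real n)" using n by (simp add: le_log_iff)
  moreover have "log 2 (real n / 2) = log 2 (real n) - 1" using n by (simp add: log_divide)
  ultimately show ?thesis using card_dyadic_ranks_le[of n] n by linarith
qed

text \<open>
  The rank used for the power: its frequency \<open>k/n\<close> lies in \<open>]1/4, 1/2]\<close>, away from \<open>0\<close> and \<open>1\<close>
  uniformly in \<open>n\<close>.
\<close>

lemma ex_large_dyadic_rank:
  assumes "2 \<le> n"
  obtains k where "k \<in> dyadic_ranks n" "n < 4 * k"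
proof -
  have "Max (dyadic_ranks n) \<in> dyadic_ranks n" (is "?k \<in> _")
    using finite_dyadic_ranks[OF assms] dyadic_ranks_nonempty[OF assms] by (rule Max_in)
  moreover have "n < 4 * ?k"
  proof (rule ccontr)
    assume "\<not> n < 4 * ?k"
    moreover obtain j where "?k = 2 ^ j" using \<open>?k \<in> _\<close> assms by (auto simp: dyadic_ranks_iff)
    \<comment> \<open>Otherwise twice the largest rank would be a rank.\<close>
    ultimately have "2 * ?k \<in> dyadic_ranks n"
      unfolding dyadic_ranks_iff[OF assms] by (intro exI[of _ "Suc j"]) auto
    then have "2 * ?k \<le> ?k" using finite_dyadic_ranks[OF assms] by (intro Max_ge)
    then show False using dyadic_ranks_bounds(1)[OF assms \<open>?k \<in> _\<close>] by simp
  qed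
  ultimately show thesis by (rule that)
qed

section \<open>The test as a union of one-sided tests\<close>

lemma Max_of_bool:
  assumes "finite A" "A \<noteq> {}"
  shows "(MAX k\<in>A. of_bool (P k)) = (of_bool (\<exists>k\<in>A. P k) :: nat)"
  using assms by (intro Max_eqI) auto

lemma T_plus_eq:
  assumes "2 \<le> n"
  shows "T_plus n a z = of_bool (\<exists>k\<in>dyadic_ranks n.
    order_quantile n (calibrated_level n a) k < order_stat n z (n - k + 1))"
  unfolding T_plus_def
  by (rule Max_of_bool) (use assms finite_dyadic_ranks dyadic_ranks_nonempty in auto)

text \<open>
  Reflection turns the points below \<open>- q\<close> into the points above \<open>q\<close>. Only the upper test has to be
  studied after this.
\<close>

lemma T_minus_eq_T_plus_uminus:
  assumes "2 \<le> n"
  shows "T_minus n a z = T_plus n a (\<lambda>i. - z i)"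
  unfolding T_plus_def T_minus_def
proof (intro arg_cong[where f = Max] image_cong refl)
  fix k assume "k \<in> dyadic_ranks n"
  then have k: "1 \<le> k" "k \<le> n" using dyadic_ranks_bounds[OF assms] by auto
  let ?q = "order_quantile n (calibrated_level n a) k"
  have "order_stat n z k < - ?q \<longleftrightarrow> k \<le> card {i \<in> {1..n}. z i < - ?q}"
    by (rule order_stat_downward_iff[OF k]) auto
  also have "{i \<in> {1..n}. z i < - ?q} = {i \<in> {1..n}. ?q < - z i}" by auto
  also have "k \<le> card \<dots> \<longleftrightarrow> ?q < order_stat n (\<lambda>i. - z i) (n - k + 1)"
    by (rule order_stat_greater_iff[OF k, symmetric])
  finally show "of_bool (order_stat n z k < - ?q) =
    (of_bool (?q < order_stat n (\<lambda>i. - z i) (n - k + 1)) :: nat)" by simp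
qed

lemma Psi3_eq:
  assumes "2 \<le> n" "1 \<le> d"
  shows "Psi3 n d \<alpha> x = of_bool (\<exists>j\<in>{1..d}. \<exists>s\<in>{1, -1}.
    T_plus n (\<alpha> / (2 * real d)) (\<lambda>i. s * x i j) = 1)"
proof -
  have "Psi3 n d \<alpha> x = (MAX j\<in>{1..d}. of_bool (\<exists>s\<in>{1, -1}.
      T_plus n (\<alpha> / (2 * real d)) (\<lambda>i. s * x i j) = 1))"
    unfolding Psi3_def T_minus_eq_T_plus_uminus[OF assms(1)]
    by (intro arg_cong[where f = Max] image_cong refl) (auto simp: T_plus_eq[OF assms(1)])
  also have "\<dots> = of_bool (\<exists>j\<in>{1..d}. \<exists>s\<in>{1, -1}.
    T_plus n (\<alpha> / (2 * real d)) (\<lambda>i. s * x i j) = 1)"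
    by (rule Max_of_bool) (use assms(2) in auto)
  finally show ?thesis .
qed

text \<open>
  The product measures live on functions that are undefined outside \<open>{1..n}\<close>, whereas the test is
  applied to unrestricted samples.
\<close>

lemma T_plus_restrict: "T_plus n a (\<lambda>i\<in>{1..n}. z i) = T_plus n a z"
proof -
  have "order_stat n (\<lambda>i\<in>{1..n}. z i) k = order_stat n z k" for k
    by (rule order_stat_cong) simp
  then show ?thesis unfolding T_plus_def by simp
qed

lemma measurable_T_plus:
  assumes n: "2 \<le> n" and f: "\<And>i. i \<in> {1..n} \<Longrightarrow> (\<lambda>x. f x i) \<in> borel_measurable M"
  shows "(\<lambda>x. T_plus n a (f x)) \<in> M \<rightarrow>\<^sub>M count_space UNIV"
proof -
  have "Measurable.pred M (\<lambda>x. \<exists>k\<in>dyadic_ranks n.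
      order_quantile n (calibrated_level n a) k < order_stat n (f x) (n - k + 1))"
  proof (intro pred_intros_finite finite_dyadic_ranks n)
    fix k assume "k \<in> dyadic_ranks n"
    then have "1 \<le> n - k + 1" "n - k + 1 \<le> n" using dyadic_ranks_bounds[OF n] by fastforce+
    then have [measurable]: "(\<lambda>x. order_stat n (f x) (n - k + 1)) \<in> borel_measurable M"
      using f by (rule borel_measurable_order_stat)
    show "Measurable.pred M (\<lambda>x.
        order_quantile n (calibrated_level n a) k < order_stat n (f x) (n - k + 1))"
      by measurable
  qed
  then show ?thesis unfolding T_plus_eq[OF n] by measurable
qed

section \<open>The Gaussian tail\<close>

lemma measure_std_normal_singleton: "measure std_normal_distribution {x} = 0"
proof -
  have "emeasure std_normal_distribution {x} =
    (\<integral>\<^sup>+ y. ennreal (std_normal_density y) * indicator {x} y \<partial>lborel)"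
    by (simp add: emeasure_density)
  also have "\<dots> = (\<integral>\<^sup>+ (y::real). 0 \<partial>lborel)"
    by (rule nn_integral_cong_AE) (use AE_lborel_singleton[of x] in \<open>auto elim: eventually_mono\<close>)
  finally show ?thesis by (simp add: measure_def)
qed

lemma std_normal_density_ge:
  assumes "\<bar>x\<bar> \<le> B"
  shows "std_normal_density B \<le> std_normal_density x"
  using power_mono[OF assms, of 2] by (auto simp: std_normal_density_def intro!: divide_right_mono)

lemma measure_std_normal_Ioc_ge:
  assumes "x \<le> y" "\<And>u. u \<in> {x<..y} \<Longrightarrow> \<bar>u\<bar> \<le> B"
  shows "(y - x) * std_normal_density B \<le> measure std_normal_distribution {x<..y}"
proof -
  interpret real_distribution std_normal_distribution by (rule real_dist_normal_dist)
  have "ennreal ((y - x) * std_normal_density B) =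
    (\<integral>\<^sup>+ u. ennreal (std_normal_density B) * indicator {x<..y} u \<partial>lborel)"
    using assms(1) by (simp add: nn_integral_cmult_indicator ennreal_mult'' mult.commute)
  also have "\<dots> \<le> (\<integral>\<^sup>+ u. ennreal (std_normal_density u) * indicator {x<..y} u \<partial>lborel)"
    by (intro nn_integral_mono) (auto simp: indicator_def intro!: ennreal_leI std_normal_density_ge assms(2))
  also have "\<dots> = emeasure std_normal_distribution {x<..y}"
    by (simp add: emeasure_density)
  finally show ?thesis by (simp add: emeasure_eq_measure)
qed

lemma measure_std_normal_Ioc_pos:
  assumes "x < y"
  shows "0 < measure std_normal_distribution {x<..y}"
proof -
  have "0 < (y - x) * std_normal_density (max \<bar>x\<bar> \<bar>y\<bar>)"
    using assms by (simp add: normal_density_pos)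
  also have "\<dots> \<le> measure std_normal_distribution {x<..y}"
    by (rule measure_std_normal_Ioc_ge) (use assms in auto)
  finally show ?thesis .
qed

lemma std_normal_tail_eq: "measure std_normal_distribution {t<..} = 1 - cdf std_normal_distribution t"
proof -
  interpret real_distribution std_normal_distribution by (rule real_dist_normal_dist)
  have "{t<..} = space std_normal_distribution - {..t}" by auto
  then show ?thesis using prob_compl[of "{..t}"] by (simp add: cdf_def)
qed

lemma std_normal_tail_integral_le_1: "(LBINT x:{M..}. std_normal_density x) \<le> 1"
proof -
  have "(LBINT x:{M..}. std_normal_density x) \<le> (LBINT x. std_normal_density x)"
    unfolding set_lebesgue_integral_def
    by (intro integral_mono integrable_mult_indicator) (auto simp: indicator_def)
  also have "\<dots> = 1" by simp
  finally show ?thesis .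
qed

text \<open>
  By continuity the tail takes all intermediate values; monotonicity confines the arguments at which
  it takes values in a compact subinterval of \<open>]0, 1[\<close> to a bounded set.
\<close>

lemma ex_std_normal_tail_between:
  assumes "0 < p\<^sub>0" "p\<^sub>1 < 1"
  shows "\<exists>B>0. \<forall>p\<in>{p\<^sub>0..p\<^sub>1}. \<exists>t. \<bar>t\<bar> \<le> B \<and> measure std_normal_distribution {t<..} = p"
proof -
  interpret real_distribution std_normal_distribution by (rule real_dist_normal_dist)
  let ?F = "cdf std_normal_distribution"
  have "eventually (\<lambda>t. ?F t < 1 - p\<^sub>1) at_bot"
    by (rule order_tendstoD[OF cdf_lim_at_bot]) (use assms in simp)
  then obtain a where a: "?F a < 1 - p\<^sub>1" by (auto simp: eventually_at_bot_linorder)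
  have "eventually (\<lambda>t. 1 - p\<^sub>0 < ?F t) at_top"
    by (rule order_tendstoD[OF cdf_lim_at_top_prob]) (use assms in simp)
  then obtain b where b: "1 - p\<^sub>0 < ?F b" by (auto simp: eventually_at_top_linorder)
  have "\<exists>t. \<bar>t\<bar> \<le> \<bar>a\<bar> + \<bar>b\<bar> + 1 \<and> measure std_normal_distribution {t<..} = p"
    if p: "p \<in> {p\<^sub>0..p\<^sub>1}" for p
  proof -
    have ab: "?F a < 1 - p" "1 - p < ?F b" using a b p by auto
    then have "a \<le> b" using cdf_nondecreasing[of b a] by linarith
    then obtain t where "a \<le> t" "t \<le> b" "?F t = 1 - p"
      using IVT[of ?F a "1 - p" b] ab isCont_cdf measure_std_normal_singleton by auto
    then show ?thesis by (intro exI[of _ t]) (auto simp: std_normal_tail_eq)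
  qed
  then show ?thesis by (intro exI[of _ "\<bar>a\<bar> + \<bar>b\<bar> + 1"]) auto
qed

section \<open>Order statistics of a Gaussian sample\<close>

lemma prob_space_gauss_sample: "prob_space (gauss_sample n)"
  unfolding gauss_sample_def
  by (intro prob_space_PiM prob_space_normal_density) simp

lemma sets_gauss_sample [measurable_cong]: "sets (gauss_sample n) = sets (\<Pi>\<^sub>M i\<in>{1..n}. borel)"
  unfolding gauss_sample_def by (intro sets_PiM_cong) auto

lemma gauss_sample_component_prob:
  assumes "i \<in> {1..n}" "A \<in> sets borel"
  shows "\<P>(z in gauss_sample n. z i \<in> A) = measure std_normal_distribution A"
proof -
  interpret product_prob_space "\<lambda>_. std_normal_distribution" "{1..n}"
    by (intro product_prob_spaceI prob_space_normal_density) simp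
  show ?thesis
    using emeasure_PiM_Collect_single[OF assms(1), of A] assms(2)
    by (simp add: gauss_sample_def measure_def)
qed

lemma gauss_sample_order_stat_measurable:
  assumes "1 \<le> k" "k \<le> n"
  shows "(\<lambda>z. order_stat n z k) \<in> borel_measurable (gauss_sample n)"
  by (rule borel_measurable_order_stat[OF assms]) measurable

text \<open>
  The distribution function \<open>F\<^sub>k\<close> of the \<open>k\<close>-th largest value of a standard Gaussian sample.
\<close>

definition order_stat_cdf :: "nat \<Rightarrow> nat \<Rightarrow> real \<Rightarrow> real" where
  "order_stat_cdf n k = cdf (distr (gauss_sample n) borel (\<lambda>z. order_stat n z (n - k + 1)))"

lemma order_stat_cdf_eq:
  assumes "1 \<le> k" "k \<le> n"
  shows "order_stat_cdf n k t = \<P>(z in gauss_sample n. order_stat n z (n - k + 1) \<le> t)"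
proof -
  have "(\<lambda>z. order_stat n z (n - k + 1)) \<in> borel_measurable (gauss_sample n)"
    by (rule gauss_sample_order_stat_measurable) (use assms in auto)
  then show ?thesis
    unfolding order_stat_cdf_def cdf_def by (subst measure_distr) (auto intro!: arg_cong[where f = "measure _"])
qed

lemma prob_order_stat_greater:
  assumes "1 \<le> k" "k \<le> n"
  shows "\<P>(z in gauss_sample n. t < order_stat n z (n - k + 1)) = 1 - order_stat_cdf n k t"
proof -
  interpret prob_space "gauss_sample n" by (rule prob_space_gauss_sample)
  let ?os = "\<lambda>z. order_stat n z (n - k + 1)"
  have [measurable]: "?os \<in> borel_measurable (gauss_sample n)"
    by (rule gauss_sample_order_stat_measurable) (use assms in auto)
  have "{z \<in> space (gauss_sample n). ?os z \<le> t} \<in> events" by measurable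
  from prob_compl[OF this]
  have "1 - order_stat_cdf n k t = prob (space (gauss_sample n) - {z \<in> space (gauss_sample n). ?os z \<le> t})"
    unfolding order_stat_cdf_eq[OF assms] by simp
  also have "space (gauss_sample n) - {z \<in> space (gauss_sample n). ?os z \<le> t} =
    {z \<in> space (gauss_sample n). t < ?os z}" by auto
  finally show ?thesis by simp
qed

text \<open>
  With positive probability all sample points fall into \<open>{x<..y}\<close>, and then so does the order statistic.
\<close>

lemma order_stat_cdf_strict_mono:
  assumes k: "1 \<le> k" "k \<le> n" and "x < y"
  shows "order_stat_cdf n k x < order_stat_cdf n k y"
proof -
  interpret prob_space "gauss_sample n" by (rule prob_space_gauss_sample)
  interpret G: product_prob_space "\<lambda>_. std_normal_distribution" "{1..n}"
    by (intro product_prob_spaceI prob_space_normal_density) simp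
  have nk: "1 \<le> n - k + 1" "n - k + 1 \<le> n" using k by auto
  let ?os = "\<lambda>z. order_stat n z (n - k + 1)"
  have os [measurable]: "?os \<in> borel_measurable (gauss_sample n)"
    by (rule gauss_sample_order_stat_measurable[OF nk])
  interpret D: real_distribution "distr (gauss_sample n) borel ?os"
    using os by (rule real_distribution_distr)
  have "0 < (\<Prod>i\<in>{1..n}. measure std_normal_distribution {x<..y})"
    using measure_std_normal_Ioc_pos[OF \<open>x < y\<close>] by (intro prod_pos) auto
  also have "\<dots> = \<P>(z in gauss_sample n. \<forall>i\<in>{1..n}. z i \<in> {x<..y})"
  proof -
    have "emeasure (gauss_sample n) {z \<in> space (gauss_sample n). \<forall>i\<in>{1..n}. z i \<in> {x<..y}}
      = (\<Prod>i\<in>{1..n}. emeasure std_normal_distribution {x<..y})"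
      using G.emeasure_PiM_Collect[of "{1..n}" "\<lambda>_. {x<..y}"] by (simp add: gauss_sample_def)
    then show ?thesis
      by (simp add: emeasure_eq_measure G.M.emeasure_eq_measure prod_ennreal ennreal_power)
  qed
  also have "\<dots> \<le> \<P>(z in gauss_sample n. ?os z \<in> {x<..y})"
  proof (intro finite_measure_mono subsetI)
    fix z assume z: "z \<in> {z \<in> space (gauss_sample n). \<forall>i\<in>{1..n}. z i \<in> {x<..y}}"
    obtain i where "i \<in> {1..n}" "?os z = z i" using nk by (rule order_stat_in_sample)
    with z show "z \<in> {z \<in> space (gauss_sample n). ?os z \<in> {x<..y}}" by auto
  qed measurable
  also have "\<dots> = measure (distr (gauss_sample n) borel ?os) {x<..y}"
    by (subst measure_distr[OF os]) (auto intro!: arg_cong[where f = "measure _"])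
  also have "\<dots> = order_stat_cdf n k y - order_stat_cdf n k x"
    unfolding order_stat_cdf_def by (rule D.cdf_diff_eq[OF \<open>x < y\<close>, symmetric])
  finally show ?thesis by simp
qed

lemma order_stat_cdf_less_iff:
  assumes "1 \<le> k" "k \<le> n"
  shows "order_stat_cdf n k x < order_stat_cdf n k y \<longleftrightarrow> x < y"
  using order_stat_cdf_strict_mono[OF assms, of x y] order_stat_cdf_strict_mono[OF assms, of y x]
  by (cases x y rule: linorder_cases) auto

text \<open>
  The Gaussian law has no atoms, so by a union bound over the sample points neither has the law of an
  order statistic.
\<close>

lemma isCont_order_stat_cdf:
  assumes k: "1 \<le> k" "k \<le> n"
  shows "isCont (order_stat_cdf n k) x"
proof -
  interpret prob_space "gauss_sample n" by (rule prob_space_gauss_sample)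
  have nk: "1 \<le> n - k + 1" "n - k + 1 \<le> n" using k by auto
  let ?os = "\<lambda>z. order_stat n z (n - k + 1)"
  have os [measurable]: "?os \<in> borel_measurable (gauss_sample n)"
    by (rule gauss_sample_order_stat_measurable[OF nk])
  interpret D: real_distribution "distr (gauss_sample n) borel ?os"
    using os by (rule real_distribution_distr)
  have "measure (distr (gauss_sample n) borel ?os) {x} = prob {z \<in> space (gauss_sample n). ?os z = x}"
    by (subst measure_distr[OF os]) (auto intro!: arg_cong[where f = prob])
  also have "\<dots> \<le> prob (\<Union>i\<in>{1..n}. {z \<in> space (gauss_sample n). z i \<in> {x}})"
  proof (intro finite_measure_mono subsetI)
    fix z assume z: "z \<in> {z \<in> space (gauss_sample n). ?os z = x}"
    obtain i where "i \<in> {1..n}" "?os z = z i" using nk by (rule order_stat_in_sample)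
    with z show "z \<in> (\<Union>i\<in>{1..n}. {z \<in> space (gauss_sample n). z i \<in> {x}})" by auto
  qed measurable
  also have "\<dots> \<le> (\<Sum>i\<in>{1..n}. prob {z \<in> space (gauss_sample n). z i \<in> {x}})"
    by (intro finite_measure_subadditive_finite) auto
  also have "\<dots> = (\<Sum>i\<in>{1..n}. 0)"
    by (intro sum.cong refl) (subst gauss_sample_component_prob, auto simp: measure_std_normal_singleton)
  finally have "measure (distr (gauss_sample n) borel ?os) {x} = 0"
    by (simp add: measure_le_0_iff)
  then show ?thesis unfolding order_stat_cdf_def D.isCont_cdf .
qed

lemma ex_order_stat_cdf_eq:
  assumes k: "1 \<le> k" "k \<le> n" and p: "0 < p" "p < 1"
  shows "\<exists>x. order_stat_cdf n k x = p"
proof -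
  interpret prob_space "gauss_sample n" by (rule prob_space_gauss_sample)
  have nk: "1 \<le> n - k + 1" "n - k + 1 \<le> n" using k by auto
  let ?os = "\<lambda>z. order_stat n z (n - k + 1)"
  have os [measurable]: "?os \<in> borel_measurable (gauss_sample n)"
    by (rule gauss_sample_order_stat_measurable[OF nk])
  interpret D: real_distribution "distr (gauss_sample n) borel ?os"
    using os by (rule real_distribution_distr)
  have "eventually (\<lambda>x. order_stat_cdf n k x < p) at_bot"
    unfolding order_stat_cdf_def using D.cdf_lim_at_bot p(1) by (rule order_tendstoD)
  then obtain a where a: "order_stat_cdf n k a < p" by (auto simp: eventually_at_bot_linorder)
  have "eventually (\<lambda>x. p < order_stat_cdf n k x) at_top"
    unfolding order_stat_cdf_def using D.cdf_lim_at_top_prob p(2) by (rule order_tendstoD)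
  then obtain b where b: "p < order_stat_cdf n k b" by (auto simp: eventually_at_top_linorder)
  from a b have "order_stat_cdf n k a < order_stat_cdf n k b" by simp
  then have "a \<le> b" by (simp add: order_stat_cdf_less_iff[OF k])
  then show ?thesis
    using IVT[of "order_stat_cdf n k" a p b] a b isCont_order_stat_cdf[OF k] by auto
qed

lemma order_stat_cdf_order_quantile:
  assumes k: "1 \<le> k" "k \<le> n" and u: "0 < u" "u < 1"
  shows "order_stat_cdf n k (order_quantile n u k) = 1 - u"
proof -
  obtain x where x: "order_stat_cdf n k x = 1 - u"
    using ex_order_stat_cdf_eq[OF k, of "1 - u"] u by auto
  \<comment> \<open>The superlevel set is a closed half line, so the quantile is a genuine inverse.\<close>
  have "{y. 1 - u \<le> order_stat_cdf n k y} = {x..}"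
    using order_stat_cdf_less_iff[OF k] by (auto simp: x[symmetric] not_less[symmetric])
  then show ?thesis
    unfolding order_quantile_def quantile_def order_stat_cdf_def[symmetric] by (simp add: x)
qed

text \<open>
  Exceeding the quantile at level \<open>u\<close> means having a p-value less than \<open>u\<close>. The strict inequalities on
  both sides are what makes the calibration events left continuous in \<open>u\<close>.
\<close>

lemma order_quantile_less_iff:
  assumes "1 \<le> k" "k \<le> n" "0 < u" "u < 1"
  shows "order_quantile n u k < x \<longleftrightarrow> 1 - order_stat_cdf n k x < u"
  using order_stat_cdf_less_iff[OF assms(1,2), of "order_quantile n u k" x]
  by (auto simp: order_stat_cdf_order_quantile[OF assms])

section \<open>The calibrated level\<close>

definition calibration_event :: "nat \<Rightarrow> real \<Rightarrow> (nat \<Rightarrow> real) set" where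
  "calibration_event n u = {z \<in> space (gauss_sample n).
     \<exists>k\<in>dyadic_ranks n. order_stat n z (n - k + 1) > order_quantile n u k}"

lemma calibration_event_eq:
  assumes "2 \<le> n" "0 < u" "u < 1"
  shows "calibration_event n u = {z \<in> space (gauss_sample n).
    \<exists>k\<in>dyadic_ranks n. 1 - order_stat_cdf n k (order_stat n z (n - k + 1)) < u}"
  using order_quantile_less_iff[OF _ _ assms(2,3)] dyadic_ranks_bounds[OF assms(1)]
  unfolding calibration_event_def by blast

lemma exceedance_event_measurable:
  assumes "2 \<le> n" "k \<in> dyadic_ranks n"
  shows "{z \<in> space (gauss_sample n). t < order_stat n z (n - k + 1)} \<in> sets (gauss_sample n)"
proof -
  have [measurable]: "(\<lambda>z. order_stat n z (n - k + 1)) \<in> borel_measurable (gauss_sample n)"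
    by (rule gauss_sample_order_stat_measurable)
      (use dyadic_ranks_bounds[OF assms] in auto)
  show ?thesis by measurable
qed

lemma calibration_event_UN:
  "calibration_event n u = (\<Union>k\<in>dyadic_ranks n.
     {z \<in> space (gauss_sample n). order_quantile n u k < order_stat n z (n - k + 1)})"
  unfolding calibration_event_def by auto

lemma calibration_event_measurable:
  assumes "2 \<le> n"
  shows "calibration_event n u \<in> sets (gauss_sample n)"
  unfolding calibration_event_UN
  by (intro sets.finite_UN finite_dyadic_ranks assms exceedance_event_measurable)

lemma prob_exceed_order_quantile:
  assumes "2 \<le> n" "k \<in> dyadic_ranks n" "0 < u" "u < 1"
  shows "\<P>(z in gauss_sample n. order_quantile n u k < order_stat n z (n - k + 1)) = u"
  using dyadic_ranks_bounds[OF assms(1,2)] assms(3,4)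
  by (subst prob_order_stat_greater) (auto simp: order_stat_cdf_order_quantile)

text \<open>
  Rank \<open>1\<close> alone already exceeds its quantile with probability \<open>u\<close>. Hence no level above \<open>a\<close> is
  admissible in the calibration, which keeps the calibrated level away from \<open>1\<close>, where the quantiles
  degenerate.
\<close>

lemma calibration_prob_ge:
  assumes "2 \<le> n" "0 < u" "u < 1"
  shows "u \<le> measure (gauss_sample n) (calibration_event n u)"
proof -
  interpret prob_space "gauss_sample n" by (rule prob_space_gauss_sample)
  note one = one_in_dyadic_ranks[OF assms(1)]
  have "u = \<P>(z in gauss_sample n. order_quantile n u 1 < order_stat n z (n - 1 + 1))"
    by (rule prob_exceed_order_quantile[OF assms(1) one assms(2,3), symmetric])
  also have "\<dots> \<le> measure (gauss_sample n) (calibration_event n u)"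
    using one by (intro finite_measure_mono calibration_event_measurable assms)
      (unfold calibration_event_UN, blast)
  finally show ?thesis .
qed

lemma calibration_prob_le:
  assumes "2 \<le> n" "0 < u" "u < 1"
  shows "measure (gauss_sample n) (calibration_event n u) \<le> real (card (dyadic_ranks n)) * u"
proof -
  interpret prob_space "gauss_sample n" by (rule prob_space_gauss_sample)
  have "measure (gauss_sample n) (calibration_event n u) \<le>
    (\<Sum>k\<in>dyadic_ranks n. \<P>(z in gauss_sample n. order_quantile n u k < order_stat n z (n - k + 1)))"
    unfolding calibration_event_UN
    by (intro finite_measure_subadditive_finite finite_dyadic_ranks assms image_subsetI
        exceedance_event_measurable)
  also have "\<dots> = (\<Sum>k\<in>dyadic_ranks n. u)"
    by (intro sum.cong refl prob_exceed_order_quantile assms)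
  finally show ?thesis by simp
qed

lemma calibration_event_mono:
  assumes "2 \<le> n" "0 < u" "u \<le> v" "v < 1"
  shows "calibration_event n u \<subseteq> calibration_event n v"
  using assms by (auto simp: calibration_event_eq intro: less_le_trans)

lemma calibrated_level_eq:
  "calibrated_level n a = Sup {u \<in> {0<..<1}. measure (gauss_sample n) (calibration_event n u) \<le> a}"
  unfolding calibrated_level_def calibration_event_def ..

text \<open>
  The Bonferroni level is admissible, which bounds the calibrated level from below.
\<close>

lemma scaled_level_admissible:
  assumes n: "2 \<le> n" and a: "0 < a" "a < 1"
  shows "a / card (dyadic_ranks n) \<in> {u \<in> {0<..<1}. measure (gauss_sample n) (calibration_event n u) \<le> a}"
proof -
  let ?m = "real (card (dyadic_ranks n))"
  have m: "1 \<le> ?m" using card_dyadic_ranks_pos[OF n] by linarith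
  have pos: "0 < a / ?m" using a m by (intro divide_pos_pos) auto
  have "a / ?m \<le> a / 1" using a m by (intro divide_left_mono) auto
  then have "a / ?m < 1" using a by simp
  with pos show ?thesis
    using calibration_prob_le[OF n, of "a / ?m"] m by auto
qed

lemma calibrated_level_bounds:
  assumes n: "2 \<le> n" and a: "0 < a" "a < 1"
  shows "a / card (dyadic_ranks n) \<le> calibrated_level n a" "calibrated_level n a \<le> a"
    "0 < calibrated_level n a" "calibrated_level n a < 1"
proof -
  let ?S = "{u \<in> {0<..<1}. measure (gauss_sample n) (calibration_event n u) \<le> a}"
  let ?m = "real (card (dyadic_ranks n))"
  have m: "1 \<le> ?m" using card_dyadic_ranks_pos[OF n] by linarith
  have inS: "a / ?m \<in> ?S" by (rule scaled_level_admissible[OF n a])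
  have pos: "0 < a / ?m" using a m by (intro divide_pos_pos) auto
  have upper: "u \<le> a" if "u \<in> ?S" for u
    using that calibration_prob_ge[OF n, of u] by auto
  show lower: "a / ?m \<le> calibrated_level n a"
    unfolding calibrated_level_eq by (rule cSup_upper[OF inS]) (rule bdd_aboveI[OF upper])
  show le: "calibrated_level n a \<le> a"
    unfolding calibrated_level_eq by (rule cSup_least) (use inS upper in blast)+
  show "0 < calibrated_level n a" using lower pos by linarith
  show "calibrated_level n a < 1" using le a by linarith
qed

text \<open>
  The supremum defining the calibrated level is attained. All levels below the supremum are
  admissible by monotonicity, and along a sequence \<open>u\<^sub>m\<close> increasing to \<open>s\<close> the calibration events
  increase to the one at \<open>s\<close>, because a p-value less than \<open>s\<close> is less than some \<open>u\<^sub>m\<close>; continuity from below concludes.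
\<close>

lemma calibrated_level_sound:
  assumes n: "2 \<le> n" and a: "0 < a" "a < 1"
  shows "measure (gauss_sample n) (calibration_event n (calibrated_level n a)) \<le> a"
proof -
  interpret prob_space "gauss_sample n" by (rule prob_space_gauss_sample)
  let ?S = "{u \<in> {0<..<1}. prob (calibration_event n u) \<le> a}"
  define s where "s = calibrated_level n a"
  have s: "0 < s" "s < 1" using calibrated_level_bounds[OF n a] by (simp_all add: s_def)
  have below: "prob (calibration_event n u) \<le> a" if "0 < u" "u < s" for u
  proof -
    have ne: "?S \<noteq> {}" using scaled_level_admissible[OF n a] by blast
    have "u < Sup ?S" using that(2) unfolding s_def calibrated_level_eq .
    then obtain v where v: "v \<in> ?S" "u < v" using ne by (rule less_cSupE)
    then have "prob (calibration_event n u) \<le> prob (calibration_event n v)"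
      using that by (intro finite_measure_mono calibration_event_mono calibration_event_measurable n) auto
    with v show ?thesis by simp
  qed
  \<comment> \<open>Any sequence in \<open>]0, s[\<close> increasing to \<open>s\<close> would do.\<close>
  define u where "u m = s * (1 - inverse (real (Suc (Suc m))))" for m
  have u: "0 < u m" "u m < s" for m
    using s by (auto simp: u_def field_simps intro!: add_pos_nonneg)
  have inc: "incseq u"
    unfolding u_def using s by (intro incseq_SucI mult_left_mono) (auto simp: field_simps)
  have "(\<lambda>m. inverse (real (Suc (Suc m)))) \<longlonglongrightarrow> 0"
    using LIMSEQ_inverse_real_of_nat by (rule LIMSEQ_Suc)
  then have "u \<longlonglongrightarrow> s * (1 - 0)"
    unfolding u_def by (intro tendsto_intros)
  then have lim: "u \<longlonglongrightarrow> s" by simp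
  have "(\<Union>m. calibration_event n (u m)) = calibration_event n s"
  proof (intro equalityI subsetI)
    fix z assume "z \<in> (\<Union>m. calibration_event n (u m))"
    then show "z \<in> calibration_event n s"
      using calibration_event_mono[OF n u(1) less_imp_le[OF u(2)] s(2)] by blast
  next
    fix z assume "z \<in> calibration_event n s"
    then obtain k where z: "z \<in> space (gauss_sample n)" and k: "k \<in> dyadic_ranks n"
      and "1 - order_stat_cdf n k (order_stat n z (n - k + 1)) < s"
      unfolding calibration_event_eq[OF n s] by auto
    from order_tendstoD(1)[OF lim this(3)] obtain m
      where "1 - order_stat_cdf n k (order_stat n z (n - k + 1)) < u m"
      by (auto simp: eventually_sequentially)
    with z k have "z \<in> calibration_event n (u m)"
      unfolding calibration_event_eq[OF n u(1) less_trans[OF u(2) s(2)]] by blast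
    then show "z \<in> (\<Union>m. calibration_event n (u m))" by blast
  qed
  moreover have "incseq (\<lambda>m. calibration_event n (u m))"
    using inc u s by (intro incseq_SucI calibration_event_mono n) (auto dest: incseq_SucD intro: less_trans)
  ultimately have "(\<lambda>m. prob (calibration_event n (u m))) \<longlonglongrightarrow> prob (calibration_event n s)"
    using finite_Lim_measure_incseq[of "\<lambda>m. calibration_event n (u m)"]
      calibration_event_measurable[OF n] by auto
  then have "prob (calibration_event n s) \<le> a"
    by (rule LIMSEQ_le_const2) (use below u in blast)
  then show ?thesis unfolding s_def .
qed

lemma prob_T_plus_null:
  assumes n: "2 \<le> n" and a: "0 < a" "a < 1"
  shows "\<P>(z in gauss_sample n. T_plus n a z = 1) \<le> a"
proof -
  have "{z \<in> space (gauss_sample n). T_plus n a z = 1} = calibration_event n (calibrated_level n a)"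
    unfolding T_plus_eq[OF n] calibration_event_def by auto
  with calibrated_level_sound[OF n a] show ?thesis by (simp only:)
qed

section \<open>Laws of the signed coordinates\<close>

text \<open>
  The law on the real line of one coordinate of an observation. At \<open>\<epsilon> = 0\<close> it is the standard Gaussian
  law, so that the null hypothesis and the alternatives are treated together.
\<close>

definition mixture_law :: "real \<Rightarrow> real \<Rightarrow> real measure" where
  "mixture_law \<epsilon> h = density lborel
     (\<lambda>x. ennreal ((1 - \<epsilon>) * std_normal_density x + \<epsilon> * std_normal_density (x - h)))"

lemma sets_mixture_law [simp, measurable_cong]: "sets (mixture_law \<epsilon> h) = sets borel"
  by (simp add: mixture_law_def)

lemma space_mixture_law [simp]: "space (mixture_law \<epsilon> h) = UNIV"
  by (simp add: mixture_law_def)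

lemma emeasure_mixture_law:
  assumes "0 \<le> \<epsilon>" "\<epsilon> \<le> 1" and A [measurable]: "A \<in> sets borel"
  shows "emeasure (mixture_law \<epsilon> h) A =
    ennreal (1 - \<epsilon>) * (\<integral>\<^sup>+ x. ennreal (std_normal_density x) * indicator A x \<partial>lborel) +
    ennreal \<epsilon> * (\<integral>\<^sup>+ x. ennreal (std_normal_density (x - h)) * indicator A x \<partial>lborel)"
proof -
  have "emeasure (mixture_law \<epsilon> h) A = (\<integral>\<^sup>+ x. ennreal (1 - \<epsilon>) * (ennreal (std_normal_density x) * indicator A x) +
      ennreal \<epsilon> * (ennreal (std_normal_density (x - h)) * indicator A x) \<partial>lborel)"
    unfolding mixture_law_def using assms
    by (subst emeasure_density)
      (auto intro!: nn_integral_cong simp: ennreal_mult ennreal_plus indicator_def split: if_splits)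
  also have "\<dots> = ennreal (1 - \<epsilon>) * (\<integral>\<^sup>+ x. ennreal (std_normal_density x) * indicator A x \<partial>lborel) +
    ennreal \<epsilon> * (\<integral>\<^sup>+ x. ennreal (std_normal_density (x - h)) * indicator A x \<partial>lborel)"
    by (subst nn_integral_add) (auto simp: nn_integral_cmult)
  finally show ?thesis .
qed

lemma nn_integral_shifted_std_normal:
  assumes [measurable]: "A \<in> sets borel"
  shows "(\<integral>\<^sup>+ x. ennreal (std_normal_density (x - h)) * indicator A x \<partial>lborel) =
    emeasure std_normal_distribution ((\<lambda>x. x + h) -` A)"
proof -
  have "(\<integral>\<^sup>+ x. ennreal (std_normal_density (x - h)) * indicator A x \<partial>lborel) =
    (\<integral>\<^sup>+ x. ennreal (std_normal_density x) * indicator A (h + x) \<partial>lborel)"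
    by (subst nn_integral_real_affine[where c = 1 and t = h]) auto
  also have "\<dots> = emeasure std_normal_distribution ((\<lambda>x. x + h) -` A)"
  proof (subst emeasure_density)
    show "(\<lambda>x. x + h) -` A \<in> sets lborel"
      using measurable_sets[of "\<lambda>x. x + h" borel borel A] by simp
  qed (auto intro!: nn_integral_cong simp: indicator_def add.commute)
  finally show ?thesis .
qed

lemma nn_integral_shifted_std_normal_UNIV:
  "(\<integral>\<^sup>+ x. ennreal (std_normal_density (x - h)) \<partial>lborel) = 1"
  using prob_space.emeasure_space_1[OF prob_space_normal_density[of 1 0]]
    nn_integral_shifted_std_normal[of UNIV h] by simp

lemma prob_space_mixture_law:
  assumes "0 \<le> \<epsilon>" "\<epsilon> \<le> 1"
  shows "prob_space (mixture_law \<epsilon> h)"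
proof
  from emeasure_mixture_law[OF assms, of UNIV h]
    nn_integral_shifted_std_normal_UNIV[of 0] nn_integral_shifted_std_normal_UNIV[of h]
  show "emeasure (mixture_law \<epsilon> h) (space (mixture_law \<epsilon> h)) = 1"
    using assms by (simp flip: ennreal_plus)
qed

lemma mixture_law_zero: "mixture_law 0 h = std_normal_distribution"
  by (simp add: mixture_law_def)

lemma measure_mixture_law_tail:
  assumes "0 \<le> \<epsilon>" "\<epsilon> \<le> 1"
  shows "measure (mixture_law \<epsilon> h) {t<..} =
    (1 - \<epsilon>) * measure std_normal_distribution {t<..} +
    \<epsilon> * measure std_normal_distribution {t - h<..}"
proof -
  interpret G: real_distribution std_normal_distribution by (rule real_dist_normal_dist)
  interpret M: prob_space "mixture_law \<epsilon> h" by (rule prob_space_mixture_law[OF assms])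
  have "(\<lambda>x. x + h) -` {t<..} = {t - h<..}" by auto
  then have "emeasure (mixture_law \<epsilon> h) {t<..} =
    ennreal (1 - \<epsilon>) * emeasure std_normal_distribution {t<..} +
    ennreal \<epsilon> * emeasure std_normal_distribution {t - h<..}"
    using emeasure_mixture_law[OF assms, of "{t<..}" h]
    by (simp add: nn_integral_shifted_std_normal emeasure_density)
  then show ?thesis
    using assms by (simp add: M.emeasure_eq_measure G.emeasure_eq_measure flip: ennreal_mult ennreal_plus)
qed

text \<open>
  Integrating a product density against a function of one coordinate leaves the marginal density
  of that coordinate, the other factors integrating to \<open>1\<close>.
\<close>

lemma nn_integral_coordinate_product:
  fixes f :: "'a \<Rightarrow> real \<Rightarrow> ennreal" and g :: "real \<Rightarrow> ennreal"
  assumes j: "j \<in> I" "finite I" and f [measurable]: "\<And>i. f i \<in> borel_measurable borel"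
    and one: "\<And>i. (\<integral>\<^sup>+ y. f i y \<partial>lborel) = 1" and g [measurable]: "g \<in> borel_measurable borel"
  shows "(\<integral>\<^sup>+ x. (\<Prod>i\<in>I. f i (x i)) * g (x j) \<partial>(\<Pi>\<^sub>M i\<in>I. lborel)) =
    (\<integral>\<^sup>+ y. f j y * g y \<partial>lborel)"
proof -
  interpret product_sigma_finite "\<lambda>_ :: 'a. lborel :: real measure" ..
  \<comment> \<open>The function of coordinate \<open>j\<close> is absorbed into the \<open>j\<close>-th factor of the product.\<close>
  let ?F = "\<lambda>i y. f i y * (if i = j then g y else 1)"
  have "(\<Prod>i\<in>I. f i (x i)) * g (x j) = (\<Prod>i\<in>I. ?F i (x i))" for x
    using j by (simp add: prod.distrib prod.delta)
  then have "(\<integral>\<^sup>+ x. (\<Prod>i\<in>I. f i (x i)) * g (x j) \<partial>(\<Pi>\<^sub>M i\<in>I. lborel)) =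
    (\<integral>\<^sup>+ x. (\<Prod>i\<in>I. ?F i (x i)) \<partial>(\<Pi>\<^sub>M i\<in>I. lborel))" by simp
  also have "\<dots> = (\<Prod>i\<in>I. \<integral>\<^sup>+ y. ?F i y \<partial>lborel)"
    by (rule product_nn_integral_prod[where f = ?F]) (use j in auto)
  also have "\<dots> = (\<Prod>i\<in>I. if i = j then \<integral>\<^sup>+ y. f j y * g y \<partial>lborel else 1)"
    by (intro prod.cong) (auto simp: one)
  also have "\<dots> = (\<integral>\<^sup>+ y. f j y * g y \<partial>lborel)"
    using j by (simp add: prod.delta)
  finally show ?thesis .
qed

text \<open>
  Since the density is even, reflecting a coordinate amounts to reflecting its shift.
\<close>

lemma nn_integral_shifted_gauss_coordinate:
  assumes j: "j \<in> {1..d}" and s: "s \<in> {1, -1}" and A [measurable]: "A \<in> sets borel"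
  shows "(\<integral>\<^sup>+ x. ennreal (std_gauss_density d (\<lambda>i. x i - \<mu> i)) * indicator A (s * x j)
      \<partial>(\<Pi>\<^sub>M i\<in>{1..d}. lborel)) =
    (\<integral>\<^sup>+ y. ennreal (std_normal_density (y - s * \<mu> j)) * indicator A y \<partial>lborel)"
proof -
  have "(\<integral>\<^sup>+ x. ennreal (std_gauss_density d (\<lambda>i. x i - \<mu> i)) * indicator A (s * x j)
      \<partial>(\<Pi>\<^sub>M i\<in>{1..d}. lborel)) =
    (\<integral>\<^sup>+ x. (\<Prod>i\<in>{1..d}. ennreal (std_normal_density (x i - \<mu> i))) * indicator A (s * x j)
      \<partial>(\<Pi>\<^sub>M i\<in>{1..d}. lborel))"
    by (simp add: std_gauss_density_def prod_ennreal)
  also have "\<dots> = (\<integral>\<^sup>+ y. ennreal (std_normal_density (y - \<mu> j)) * indicator A (s * y) \<partial>lborel)"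
    by (rule nn_integral_coordinate_product[OF j, where f = "\<lambda>i y. ennreal (std_normal_density (y - \<mu> i))"
          and g = "\<lambda>y. indicator A (s * y)"]) (auto simp: nn_integral_shifted_std_normal_UNIV)
  also have "\<dots> = (\<integral>\<^sup>+ y. ennreal (std_normal_density (y - s * \<mu> j)) * indicator A y \<partial>lborel)"
  proof (cases "s = 1")
    case False
    then have s: "s = -1" using s by simp
    have even: "std_normal_density (- y - \<mu> j) = std_normal_density (y + \<mu> j)" for y
      by (simp add: std_normal_density_def power2_eq_square algebra_simps)
    show ?thesis unfolding s
      by (subst nn_integral_real_affine[where c = "-1" and t = 0]) (auto simp: even)
  qed simp
  finally show ?thesis .
qed

lemma std_gauss_density_measurable:
  "(\<lambda>x. std_gauss_density d (\<lambda>j. x j - \<mu> j)) \<in> borel_measurable (\<Pi>\<^sub>M j\<in>{1..d}. lborel)"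
  unfolding std_gauss_density_def by measurable

lemma std_gauss_density_nonneg: "0 \<le> std_gauss_density d x"
  unfolding std_gauss_density_def by (intro prod_nonneg) auto

definition mixture_vector_law :: "nat \<Rightarrow> real \<Rightarrow> (nat \<Rightarrow> real) \<Rightarrow> (nat \<Rightarrow> real) measure" where
  "mixture_vector_law d \<epsilon> \<mu> = density (\<Pi>\<^sub>M j\<in>{1..d}. lborel) (\<lambda>x. ennreal (mixture_density d \<epsilon> \<mu> x))"

lemma sets_mixture_vector_law [simp, measurable_cong]:
  "sets (mixture_vector_law d \<epsilon> \<mu>) = sets (\<Pi>\<^sub>M j\<in>{1..d}. borel)"
  unfolding mixture_vector_law_def sets_density by (intro sets_PiM_cong) auto

lemma sample_law_mixture:
  "sample_law n d (mixture_density d \<epsilon> \<mu>) = (\<Pi>\<^sub>M i\<in>{1..n}. mixture_vector_law d \<epsilon> \<mu>)"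
  unfolding sample_law_def mixture_vector_law_def ..

lemma distr_mixture_vector_law:
  assumes j: "j \<in> {1..d}" and s: "s \<in> {1, -1}" and \<epsilon>: "0 \<le> \<epsilon>" "\<epsilon> \<le> 1"
  shows "distr (mixture_vector_law d \<epsilon> \<mu>) borel (\<lambda>x. s * x j) = mixture_law \<epsilon> (s * \<mu> j)"
proof (rule measure_eqI)
  fix A assume "A \<in> sets (distr (mixture_vector_law d \<epsilon> \<mu>) borel (\<lambda>x. s * x j))"
  then have A [measurable]: "A \<in> sets borel" by simp
  have [measurable]: "(\<lambda>x. x j) \<in> borel_measurable (mixture_vector_law d \<epsilon> \<mu>)"
    using j by simp
  then have proj: "(\<lambda>x. s * x j) \<in> borel_measurable (mixture_vector_law d \<epsilon> \<mu>)"
    by measurable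
  note [measurable] = std_gauss_density_measurable
  let ?P = "\<Pi>\<^sub>M j\<in>{1..d}. lborel :: real measure"
  have [measurable]: "(\<lambda>x. x j) \<in> borel_measurable ?P" using j by measurable
  define G where "G c x = ennreal (std_gauss_density d (\<lambda>i. x i - c i)) * indicator A (s * x j)" for c x
  have G [measurable]: "G c \<in> borel_measurable ?P" for c
    unfolding G_def by measurable
  let ?B = "(\<lambda>x. s * x j) -` A \<inter> space ?P"
  have B [measurable]: "?B \<in> sets ?P" by measurable
  have [measurable]: "(\<lambda>x. std_gauss_density d x) \<in> borel_measurable ?P"
    using std_gauss_density_measurable[of d "\<lambda>_. 0"] by simp
  have [measurable]: "(\<lambda>x. mixture_density d \<epsilon> \<mu> x) \<in> borel_measurable ?P"
    unfolding mixture_density_def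
    by (intro borel_measurable_add borel_measurable_times borel_measurable_const) measurable
  have "emeasure (distr (mixture_vector_law d \<epsilon> \<mu>) borel (\<lambda>x. s * x j)) A =
    emeasure (mixture_vector_law d \<epsilon> \<mu>) ?B"
    using emeasure_distr[OF proj A] by (simp add: mixture_vector_law_def)
  also have "\<dots> = (\<integral>\<^sup>+ x. ennreal (mixture_density d \<epsilon> \<mu> x) * indicator ?B x \<partial>?P)"
    unfolding mixture_vector_law_def by (rule emeasure_density) measurable
  also have "\<dots> = (\<integral>\<^sup>+ x. ennreal (1 - \<epsilon>) * G (\<lambda>_. 0) x + ennreal \<epsilon> * G \<mu> x \<partial>?P)"
    using \<epsilon> std_gauss_density_nonneg
    by (intro nn_integral_cong)
      (auto simp: G_def mixture_density_def indicator_def ennreal_mult ennreal_plus)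
  also have "\<dots> = ennreal (1 - \<epsilon>) * integral\<^sup>N ?P (G (\<lambda>_. 0)) + ennreal \<epsilon> * integral\<^sup>N ?P (G \<mu>)"
    by (subst nn_integral_add, measurable, measurable, simp only: nn_integral_cmult[OF G])
  also have "\<dots> = emeasure (mixture_law \<epsilon> (s * \<mu> j)) A"
    unfolding G_def nn_integral_shifted_gauss_coordinate[OF j s A] emeasure_mixture_law[OF \<epsilon> A]
    by simp
  finally show "emeasure (distr (mixture_vector_law d \<epsilon> \<mu>) borel (\<lambda>x. s * x j)) A =
    emeasure (mixture_law \<epsilon> (s * \<mu> j)) A" .
qed simp

text \<open>
  The total mass is that of any of its marginals.
\<close>

lemma prob_space_mixture_vector_law:
  assumes "1 \<le> d" "0 \<le> \<epsilon>" "\<epsilon> \<le> 1"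
  shows "prob_space (mixture_vector_law d \<epsilon> \<mu>)"
proof -
  have one: "1 \<in> {1..d}" using assms by simp
  have "(\<lambda>x. 1 * x 1) \<in> borel_measurable (mixture_vector_law d \<epsilon> \<mu>)"
    using one by simp
  moreover have "prob_space (distr (mixture_vector_law d \<epsilon> \<mu>) borel (\<lambda>x. 1 * x 1))"
    unfolding distr_mixture_vector_law[OF one insertI1 assms(2,3)]
    by (rule prob_space_mixture_law[OF assms(2,3)])
  ultimately show ?thesis by (rule prob_space_distrD)
qed

lemma distr_sample_law_coordinate:
  assumes j: "j \<in> {1..d}" and s: "s \<in> {1, -1}" and \<epsilon>: "0 \<le> \<epsilon>" "\<epsilon> \<le> 1"
  shows "distr (sample_law n d (mixture_density d \<epsilon> \<mu>)) (\<Pi>\<^sub>M i\<in>{1..n}. borel)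
      (\<lambda>x. \<lambda>i\<in>{1..n}. s * x i j) = (\<Pi>\<^sub>M i\<in>{1..n}. mixture_law \<epsilon> (s * \<mu> j))"
proof -
  let ?Q = "mixture_vector_law d \<epsilon> \<mu>"
  have d: "1 \<le> d" using j by auto
  have m: "(\<lambda>y. s * y j) \<in> ?Q \<rightarrow>\<^sub>M mixture_law \<epsilon> (s * \<mu> j)"
  proof -
    have [measurable]: "(\<lambda>x. x j) \<in> borel_measurable ?Q" using j by simp
    show ?thesis by measurable
  qed
  have "distr (sample_law n d (mixture_density d \<epsilon> \<mu>)) (\<Pi>\<^sub>M i\<in>{1..n}. borel)
      (\<lambda>x. \<lambda>i\<in>{1..n}. s * x i j) =
    distr (\<Pi>\<^sub>M i\<in>{1..n}. ?Q) (\<Pi>\<^sub>M i\<in>{1..n}. mixture_law \<epsilon> (s * \<mu> j)) (compose {1..n} (\<lambda>y. s * y j))"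
    unfolding sample_law_mixture by (intro distr_cong sets_PiM_cong) (auto simp: compose_def)
  also have "\<dots> = (\<Pi>\<^sub>M i\<in>{1..n}. distr ?Q (mixture_law \<epsilon> (s * \<mu> j)) (\<lambda>y. s * y j))"
    by (rule distr_PiM_finite_prob_space')
      (use m prob_space_mixture_vector_law[OF d \<epsilon>] prob_space_mixture_law[OF \<epsilon>] in auto)
  also have "distr ?Q (mixture_law \<epsilon> (s * \<mu> j)) (\<lambda>y. s * y j) = distr ?Q borel (\<lambda>y. s * y j)"
    by (intro distr_cong) auto
  also have "\<dots> = mixture_law \<epsilon> (s * \<mu> j)"
    by (rule distr_mixture_vector_law[OF j s \<epsilon>])
  finally show ?thesis .
qed

lemma sets_sample_law:
  "sets (sample_law n d g) = sets (\<Pi>\<^sub>M i\<in>{1..n}. \<Pi>\<^sub>M j\<in>{1..d}. borel)"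
  unfolding sample_law_def by (intro sets_PiM_cong refl) (simp cong: sets_PiM_cong)

lemma borel_measurable_entry:
  assumes i: "i \<in> {1..n}" and j: "j \<in> {1..d}"
    and M: "sets M = sets (\<Pi>\<^sub>M i\<in>{1..n}. \<Pi>\<^sub>M j\<in>{1..d}. borel :: real measure)"
  shows "(\<lambda>x. x i j) \<in> borel_measurable M"
proof -
  note [measurable_cong] = M
  have "(\<lambda>x. x i) \<in> M \<rightarrow>\<^sub>M (\<Pi>\<^sub>M j\<in>{1..d}. borel)"
    using i by measurable
  from measurable_compose[OF this measurable_component_singleton[OF j]] show ?thesis .
qed

lemma measurable_T_plus_coordinate:
  assumes n: "2 \<le> n" and j: "j \<in> {1..d}"
    and M: "sets M = sets (\<Pi>\<^sub>M i\<in>{1..n}. \<Pi>\<^sub>M j\<in>{1..d}. borel :: real measure)"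
  shows "(\<lambda>x. T_plus n a (\<lambda>i. s * x i j)) \<in> M \<rightarrow>\<^sub>M count_space UNIV"
proof (rule measurable_T_plus[OF n])
  fix i assume i: "i \<in> {1..n}"
  then show "(\<lambda>x. s * x i j) \<in> borel_measurable M"
    using borel_measurable_entry[OF i j M] by measurable
qed

text \<open>
  This reduces every probability about the \<open>d\<close>-dimensional sample to one about a real sample. The
  value \<open>v\<close> is \<open>1\<close> for the level and \<open>0\<close> for the second kind error.
\<close>

lemma prob_T_plus_coordinate:
  assumes n: "2 \<le> n" and j: "j \<in> {1..d}" and s: "s \<in> {1, -1}" and \<epsilon>: "0 \<le> \<epsilon>" "\<epsilon> \<le> 1"
  shows "\<P>(x in sample_law n d (mixture_density d \<epsilon> \<mu>). T_plus n a (\<lambda>i. s * x i j) = v) =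
    \<P>(z in \<Pi>\<^sub>M i\<in>{1..n}. mixture_law \<epsilon> (s * \<mu> j). T_plus n a z = v)"
proof -
  let ?S = "sample_law n d (mixture_density d \<epsilon> \<mu>)"
  let ?B = "\<Pi>\<^sub>M i\<in>{1..n}. borel :: real measure"
  let ?R = "\<Pi>\<^sub>M i\<in>{1..n}. mixture_law \<epsilon> (s * \<mu> j)"
  let ?g = "\<lambda>x. \<lambda>i\<in>{1..n}. s * x i j"
  have setsR: "sets ?R = sets ?B" by (intro sets_PiM_cong) auto
  have g: "?g \<in> ?S \<rightarrow>\<^sub>M ?B"
  proof (rule measurable_restrict)
    fix i assume i: "i \<in> {1..n}"
    show "(\<lambda>x. s * x i j) \<in> borel_measurable ?S"
      using borel_measurable_entry[OF i j sets_sample_law] by measurable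
  qed
  have "(\<lambda>z. T_plus n a z) \<in> ?B \<rightarrow>\<^sub>M count_space UNIV"
    by (rule measurable_T_plus[OF n]) measurable
  then have ev: "{z \<in> space ?B. T_plus n a z = v} \<in> sets ?B" by measurable
  have "\<P>(z in ?R. T_plus n a z = v) = measure (distr ?S ?B ?g) {z \<in> space ?B. T_plus n a z = v}"
    unfolding distr_sample_law_coordinate[OF j s \<epsilon>] sets_eq_imp_space_eq[OF setsR] ..
  also have "\<dots> = measure ?S (?g -` {z \<in> space ?B. T_plus n a z = v} \<inter> space ?S)"
    by (rule measure_distr[OF g ev])
  also have "?g -` {z \<in> space ?B. T_plus n a z = v} \<inter> space ?S =
    {x \<in> space ?S. T_plus n a (\<lambda>i. s * x i j) = v}"
    using measurable_space[OF g] unfolding vimage_def mem_Collect_eq T_plus_restrict by blast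
  finally show ?thesis by simp
qed

section \<open>Level of the test\<close>

lemma measurable_Psi3:
  assumes n: "2 \<le> n" "1 \<le> d"
    and M: "sets M = sets (\<Pi>\<^sub>M i\<in>{1..n}. \<Pi>\<^sub>M j\<in>{1..d}. borel :: real measure)"
  shows "Psi3 n d \<alpha> \<in> M \<rightarrow>\<^sub>M count_space {0, 1}"
proof -
  have "Measurable.pred M (\<lambda>x. \<exists>j\<in>{1..d}. \<exists>s\<in>{1, -1}.
      T_plus n (\<alpha> / (2 * real d)) (\<lambda>i. s * x i j) = 1)"
  proof (intro pred_intros_finite)
    fix j s assume "j \<in> {1..d}"
    note measurable_T_plus_coordinate[OF n(1) this M, measurable]
    show "Measurable.pred M (\<lambda>x. T_plus n (\<alpha> / (2 * real d)) (\<lambda>i. s * x i j) = 1)"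
      by measurable
  qed auto
  then have "(\<lambda>x. of_bool (\<exists>j\<in>{1..d}. \<exists>s\<in>{1, -1}.
      T_plus n (\<alpha> / (2 * real d)) (\<lambda>i. s * x i j) = 1) :: nat) \<in> M \<rightarrow>\<^sub>M count_space UNIV"
    by measurable
  moreover have "Psi3 n d \<alpha> = (\<lambda>x. of_bool (\<exists>j\<in>{1..d}. \<exists>s\<in>{1, -1}.
      T_plus n (\<alpha> / (2 * real d)) (\<lambda>i. s * x i j) = 1))"
    by (rule ext) (rule Psi3_eq[OF n])
  ultimately have "Psi3 n d \<alpha> \<in> M \<rightarrow>\<^sub>M count_space UNIV" by (simp only:)
  then show ?thesis
    by (rule measurable_count_space_extend[rotated 2]) (auto simp: Psi3_eq[OF n])
qed

text \<open>
  Under the null hypothesis each of the \<open>2 d\<close> signed coordinates yields a standard Gaussian sample, on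
  which \<open>T_plus\<close> has level \<open>\<alpha> / (2 d)\<close>.
\<close>

theorem Psi3_level:
  assumes \<alpha>: "0 < \<alpha>" "\<alpha> < 1" and n: "2 \<le> n" and d: "1 \<le> d"
  shows "test_of_level n d (Psi3 n d \<alpha>) \<alpha>"
  unfolding test_of_level_def
proof (intro conjI measurable_Psi3[OF n d refl])
  let ?a = "\<alpha> / (2 * real d)"
  have null: "std_gauss_density d = mixture_density d 0 (\<lambda>_. 0)"
    by (simp add: mixture_density_def fun_eq_iff)
  let ?S = "sample_law n d (mixture_density d 0 (\<lambda>_. 0))"
  interpret S: prob_space ?S
    unfolding sample_law_mixture by (intro prob_space_PiM prob_space_mixture_vector_law) (use d in auto)
  let ?E = "\<lambda>(j, s). {x \<in> space ?S. T_plus n ?a (\<lambda>i. s * x i j) = 1}"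
  have a: "0 < ?a" "?a < 1" using \<alpha> d by (auto simp: field_simps)
  have E: "?E js \<in> S.events" if *: "js \<in> {1..d} \<times> {1, -1}" for js
  proof -
    obtain j s where js: "js = (j, s)" "j \<in> {1..d}" using * by auto
    note measurable_T_plus_coordinate[OF n js(2) sets_sample_law, measurable]
    show ?thesis unfolding js by simp
  qed
  have "S.prob {x \<in> space ?S. Psi3 n d \<alpha> x = 1} = S.prob (\<Union>js\<in>{1..d} \<times> {1, -1}. ?E js)"
    by (rule arg_cong[where f = S.prob]) (auto simp: Psi3_eq[OF n d])
  also have "\<dots> \<le> (\<Sum>js\<in>{1..d} \<times> {1, -1}. S.prob (?E js))"
    by (intro S.finite_measure_subadditive_finite) (use E in auto)
  also have "\<dots> \<le> (\<Sum>js\<in>{1..d} \<times> {1, -1 :: real}. ?a)"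
  proof (rule sum_mono)
    fix js assume "js \<in> {1..d} \<times> {1, -1 :: real}"
    then obtain j s where js: "js = (j, s)" "j \<in> {1..d}" "s \<in> {1, -1 :: real}" by auto
    have "S.prob (?E js) = \<P>(z in gauss_sample n. T_plus n ?a z = 1)"
      using prob_T_plus_coordinate[OF n js(2,3), of 0 "\<lambda>_. 0" ?a 1]
      by (simp add: js(1) mixture_law_zero gauss_sample_def)
    also have "\<dots> \<le> ?a" by (rule prob_T_plus_null[OF n a])
    finally show "S.prob (?E js) \<le> ?a" .
  qed
  also have "\<dots> = \<alpha>" using d by (simp add: card_cartesian_product)
  finally show "\<P>(x in sample_law n d (std_gauss_density d). Psi3 n d \<alpha> x = 1) \<le> \<alpha>"
    unfolding null .
qed

section \<open>Second kind error of a one-sided test\<close>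

text \<open>
  Hoeffding's inequality for the empirical frequency of an event in an i.i.d. sample.
\<close>

lemma
  assumes P: "prob_space P" and A [measurable]: "A \<in> sets P" and n: "1 \<le> n"
    and r: "0 \<le> r"
  defines "S \<equiv> \<Pi>\<^sub>M i\<in>{1..n}. P"
  shows iid_count_upper_tail:
      "\<P>(z in S. measure P A + r \<le> real (card {i \<in> {1..n}. z i \<in> A}) / real n) \<le> exp (- 2 * real n * r\<^sup>2)"
    and iid_count_lower_tail:
      "\<P>(z in S. real (card {i \<in> {1..n}. z i \<in> A}) / real n \<le> measure P A - r) \<le> exp (- 2 * real n * r\<^sup>2)"
proof -
  interpret P: prob_space P by fact
  interpret S: prob_space S unfolding S_def by (intro prob_space_PiM P)
  let ?X = "\<lambda>i z. indicat_real A (z i)"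
  have comp: "distr S P (\<lambda>z. z i) = P" if "i \<in> {1..n}" for i
    unfolding S_def using P that by (rule distr_PiM_component)
  have proj [measurable]: "(\<lambda>z. z i) \<in> S \<rightarrow>\<^sub>M P" if "i \<in> {1..n}" for i
    unfolding S_def using that by measurable
  have "S.indep_vars (\<lambda>_. P) (\<lambda>i z. z i) {1..n}"
  proof (subst S.indep_vars_iff_distr_eq_PiM')
    have "distr S (\<Pi>\<^sub>M i\<in>{1..n}. P) (\<lambda>z. \<lambda>i\<in>{1..n}. z i) = distr S S (\<lambda>z. z)"
      unfolding S_def by (intro distr_cong refl) (auto simp: space_PiM)
    also have "\<dots> = S" by simp
    also have "S = (\<Pi>\<^sub>M i\<in>{1..n}. distr S P (\<lambda>z. z i))"
      unfolding S_def by (intro PiM_cong refl) (rule comp[unfolded S_def, symmetric])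
    finally show "distr S (\<Pi>\<^sub>M i\<in>{1..n}. P) (\<lambda>z. \<lambda>i\<in>{1..n}. z i) = (\<Pi>\<^sub>M i\<in>{1..n}. distr S P (\<lambda>z. z i))" .
  qed (use n proj in auto)
  then have indep: "S.indep_vars (\<lambda>_. borel) ?X {1..n}"
    by (rule S.indep_vars_compose2) auto
  interpret Hoeffding_ineq_iid S "{1..n}" ?X "?X 1" 0 1 "measure P A"
  proof unfold_locales
    fix i assume i: "i \<in> {1..n}"
    have *: "distr S borel (?X k) = distr P borel (indicat_real A)" if "k \<in> {1..n}" for k
    proof -
      have "distr S borel (?X k) = distr (distr S P (\<lambda>z. z k)) borel (indicat_real A)"
        using that by (subst distr_distr) (auto simp: comp_def)
      then show ?thesis by (simp add: comp[OF that])
    qed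
    show "distr S borel (?X i) = distr S borel (?X 1)"
      using *[OF i] *[of 1] n by simp
  next
    show "S.random_variable borel (?X 1)" using n by simp
  next
    have "S.expectation (?X 1) = (\<integral>y. indicat_real A y \<partial>distr S P (\<lambda>z. z 1))"
      using n by (subst integral_distr) auto
    also have "\<dots> = measure P A" using n by (simp add: comp)
    finally show "measure P A \<equiv> S.expectation (?X 1)" by simp
  qed (use indep in \<open>auto simp: indicator_def\<close>)
  have count: "(\<Sum>i\<in>{1..n}. ?X i z) = real (card {i \<in> {1..n}. z i \<in> A})" for z
    by (simp add: indicator_def sum.If_cases Int_def flip: of_bool_def)
  show "\<P>(z in S. measure P A + r \<le> real (card {i \<in> {1..n}. z i \<in> A}) / real n) \<le> exp (- 2 * real n * r\<^sup>2)"
    using Hoeffding_ineq_ge'[OF r, unfolded count] n by simp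
  show "\<P>(z in S. real (card {i \<in> {1..n}. z i \<in> A}) / real n \<le> measure P A - r) \<le> exp (- 2 * real n * r\<^sup>2)"
    using Hoeffding_ineq_le'[OF r, unfolded count] n by simp
qed

text \<open>
  The threshold \<open>t\<close> is chosen for a Gaussian sample to have \<open>k\<close> points above it with probability at most
  the Bonferroni level, hence at most the calibrated level; this says exactly that \<open>t\<close> is not below the
  quantile.
\<close>

lemma order_quantile_calibrated_le:
  assumes n: "2 \<le> n" and a: "0 < a" "a < 1" and k: "k \<in> dyadic_ranks n" and r: "0 \<le> r"
    and exp_le: "exp (- 2 * real n * r\<^sup>2) \<le> a / card (dyadic_ranks n)"
    and t: "measure std_normal_distribution {t<..} + r \<le> real k / real n"
  shows "order_quantile n (calibrated_level n a) k \<le> t"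
proof -
  note kb = dyadic_ranks_bounds[OF n k]
  note cal = calibrated_level_bounds[OF n a]
  interpret prob_space "gauss_sample n" by (rule prob_space_gauss_sample)
  have "1 - order_stat_cdf n k t = \<P>(z in gauss_sample n. t < order_stat n z (n - k + 1))"
    using kb by (simp only: prob_order_stat_greater)
  also have "\<dots> \<le> \<P>(z in gauss_sample n. measure std_normal_distribution {t<..} + r
      \<le> real (card {i \<in> {1..n}. z i \<in> {t<..}}) / real n)"
  proof (rule finite_measure_mono)
    have [measurable]: "(\<lambda>z. card {i \<in> {1..n}. z i \<in> {t<..}}) \<in> gauss_sample n \<rightarrow>\<^sub>M count_space UNIV"
      by (rule measurable_hit_count[where N = borel]) measurable
    show "{z \<in> space (gauss_sample n). measure std_normal_distribution {t<..} + r
        \<le> real (card {i \<in> {1..n}. z i \<in> {t<..}}) / real n} \<in> events"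
      by measurable
    show "{z \<in> space (gauss_sample n). t < order_stat n z (n - k + 1)} \<subseteq>
      {z \<in> space (gauss_sample n). measure std_normal_distribution {t<..} + r
        \<le> real (card {i \<in> {1..n}. z i \<in> {t<..}}) / real n}"
    proof safe
      fix z assume "t < order_stat n z (n - k + 1)"
      then have "real k / real n \<le> real (card {i \<in> {1..n}. z i \<in> {t<..}}) / real n"
        using order_stat_greater_iff[OF kb(1,3)] by (intro divide_right_mono) auto
      with t show "measure std_normal_distribution {t<..} + r
        \<le> real (card {i \<in> {1..n}. z i \<in> {t<..}}) / real n" by linarith
    qed
  qed
  also have "\<dots> \<le> exp (- 2 * real n * r\<^sup>2)"
    unfolding gauss_sample_def
    by (rule iid_count_upper_tail) (use n r in \<open>auto intro: prob_space_normal_density\<close>)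
  also have "\<dots> \<le> a / card (dyadic_ranks n)" by (rule exp_le)
  also have "\<dots> \<le> calibrated_level n a" by (rule cal)
  finally have "\<not> order_stat_cdf n k t < order_stat_cdf n k (order_quantile n (calibrated_level n a) k)"
    using kb cal by (subst order_stat_cdf_order_quantile) auto
  then show ?thesis using order_stat_cdf_less_iff[OF kb(1,3)] by simp
qed

text \<open>
  If rank \<open>k\<close> does not reject, then the \<open>k\<close>-th largest value is at most \<open>t\<close>, so fewer than \<open>k\<close> sample
  points exceed \<open>t\<close>, although about \<open>n\<close> times the mixture tail are expected. The numbers \<open>r\<close> and
  \<open>w\<close> are the deviations granted to the null frequency and to the frequency under the mixture.
\<close>

lemma T_plus_type2_error:
  assumes n: "2 \<le> n" and a: "0 < a" "a < 1" and k: "k \<in> dyadic_ranks n"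
    and \<epsilon>: "0 \<le> \<epsilon>" "\<epsilon> \<le> 1" and r: "0 \<le> r" and w: "0 \<le> w"
    and exp_r: "exp (- 2 * real n * r\<^sup>2) \<le> a / card (dyadic_ranks n)"
    and exp_w: "exp (- 2 * real n * w\<^sup>2) \<le> \<beta>"
    and t: "measure std_normal_distribution {t<..} + r \<le> real k / real n"
    and sep: "real k / real n + w \<le> measure (mixture_law \<epsilon> h) {t<..}"
  shows "\<P>(z in \<Pi>\<^sub>M i\<in>{1..n}. mixture_law \<epsilon> h. T_plus n a z = 0) \<le> \<beta>"
proof -
  let ?S = "\<Pi>\<^sub>M i\<in>{1..n}. mixture_law \<epsilon> h"
  note kb = dyadic_ranks_bounds[OF n k]
  interpret prob_space ?S by (intro prob_space_PiM prob_space_mixture_law \<epsilon>)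
  have q: "order_quantile n (calibrated_level n a) k \<le> t"
    by (rule order_quantile_calibrated_le[OF n a k r exp_r t])
  have "\<P>(z in ?S. T_plus n a z = 0) \<le> \<P>(z in ?S.
      real (card {i \<in> {1..n}. z i \<in> {t<..}}) / real n \<le> measure (mixture_law \<epsilon> h) {t<..} - w)"
  proof (rule finite_measure_mono)
    have [measurable]: "(\<lambda>z. card {i \<in> {1..n}. z i \<in> {t<..}}) \<in> ?S \<rightarrow>\<^sub>M count_space UNIV"
      by (rule measurable_hit_count[where N = borel]) measurable
    show "{z \<in> space ?S. real (card {i \<in> {1..n}. z i \<in> {t<..}}) / real n
        \<le> measure (mixture_law \<epsilon> h) {t<..} - w} \<in> events"
      by measurable
    show "{z \<in> space ?S. T_plus n a z = 0} \<subseteq>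
      {z \<in> space ?S. real (card {i \<in> {1..n}. z i \<in> {t<..}}) / real n
        \<le> measure (mixture_law \<epsilon> h) {t<..} - w}"
    proof safe
      fix z assume "T_plus n a z = 0"
      then have "\<not> order_quantile n (calibrated_level n a) k < order_stat n z (n - k + 1)"
        using k unfolding T_plus_eq[OF n] by (auto split: if_splits)
      then have "\<not> t < order_stat n z (n - k + 1)" using q by linarith
      then have "card {i \<in> {1..n}. z i \<in> {t<..}} \<le> k"
        using order_stat_greater_iff[OF kb(1,3), of t z] by simp
      then have "real (card {i \<in> {1..n}. z i \<in> {t<..}}) / real n \<le> real k / real n"
        by (intro divide_right_mono) auto
      with sep show "real (card {i \<in> {1..n}. z i \<in> {t<..}}) / real n
        \<le> measure (mixture_law \<epsilon> h) {t<..} - w" by linarith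
    qed
  qed
  also have "\<dots> \<le> exp (- 2 * real n * w\<^sup>2)"
    by (rule iid_count_lower_tail) (use n w prob_space_mixture_law[OF \<epsilon>] in auto)
  also have "\<dots> \<le> \<beta>" by (rule exp_w)
  finally show ?thesis .
qed

section \<open>Separation and rate\<close>

text \<open>
  The tail gains \<open>\<epsilon>\<close> times the Gaussian mass of \<open>{t - h<..t}\<close>, an interval of length \<open>h\<close> on which the
  density is at least its value at \<open>B + h\<close>.
\<close>

lemma mixture_tail_gain:
  assumes \<epsilon>: "0 \<le> \<epsilon>" "\<epsilon> \<le> 1" and h: "0 \<le> h" and t: "\<bar>t\<bar> \<le> B"
  shows "measure std_normal_distribution {t<..} + \<epsilon> * h * std_normal_density (B + h)
    \<le> measure (mixture_law \<epsilon> h) {t<..}"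
proof -
  interpret real_distribution std_normal_distribution by (rule real_dist_normal_dist)
  have Un: "{t - h<..} = {t - h<..t} \<union> {t<..}" using h by auto
  have split: "prob {t - h<..} = prob {t - h<..t} + prob {t<..}"
    unfolding Un by (rule finite_measure_Union) auto
  have "(t - (t - h)) * std_normal_density (B + h) \<le> prob {t - h<..t}"
    by (rule measure_std_normal_Ioc_ge) (use h t in auto)
  then have "\<epsilon> * (h * std_normal_density (B + h)) \<le> \<epsilon> * prob {t - h<..t}"
    using \<epsilon> by (intro mult_left_mono) auto
  then show ?thesis
    unfolding measure_mixture_law_tail[OF \<epsilon>] split by (simp add: algebra_simps)
qed

text \<open>
  One constant \<open>c\<close> serves all tail values in a compact subinterval of \<open>]0, 1[\<close>, all proportions and all
  shifts up to \<open>M\<close>: the thresholds then stay in some \<open>{-B..B}\<close>, and \<open>c\<close> is the density at \<open>B + M\<close>.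
\<close>

lemma ex_separating_threshold:
  assumes "0 < p\<^sub>0" "p\<^sub>1 < 1" "0 < M"
  shows "\<exists>c>0. \<forall>p\<in>{p\<^sub>0..p\<^sub>1}. \<exists>t. measure std_normal_distribution {t<..} = p \<and>
    (\<forall>\<epsilon>\<in>{0..1}. \<forall>h\<in>{0..M}. p + c * (\<epsilon> * h) \<le> measure (mixture_law \<epsilon> h) {t<..})"
proof -
  obtain B where B: "B > 0" and
    tail: "\<And>p. p \<in> {p\<^sub>0..p\<^sub>1} \<Longrightarrow> \<exists>t. \<bar>t\<bar> \<le> B \<and> measure std_normal_distribution {t<..} = p"
    using ex_std_normal_tail_between[OF assms(1,2)] by blast
  let ?c = "std_normal_density (B + M)"
  have gain: "p + ?c * (\<epsilon> * h) \<le> measure (mixture_law \<epsilon> h) {t<..}"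
    if t: "\<bar>t\<bar> \<le> B" "measure std_normal_distribution {t<..} = p" and \<epsilon>: "\<epsilon> \<in> {0..1}" and h: "h \<in> {0..M}"
    for t p \<epsilon> h
  proof -
    have "?c \<le> std_normal_density (B + h)"
      using B h by (intro std_normal_density_ge) auto
    then have "(\<epsilon> * h) * ?c \<le> (\<epsilon> * h) * std_normal_density (B + h)"
      using \<epsilon> h by (intro mult_left_mono) auto
    with mixture_tail_gain[of \<epsilon> h t B] t \<epsilon> h show ?thesis by (simp add: mult_ac)
  qed
  show ?thesis
  proof (rule exI[of _ ?c], intro conjI ballI)
    show "0 < ?c" by (simp add: normal_density_pos)
    fix p assume "p \<in> {p\<^sub>0..p\<^sub>1}"
    from tail[OF this] obtain t where "\<bar>t\<bar> \<le> B" "measure std_normal_distribution {t<..} = p" by blast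
    with gain show "\<exists>t. measure std_normal_distribution {t<..} = p \<and>
      (\<forall>\<epsilon>\<in>{0..1}. \<forall>h\<in>{0..M}. p + ?c * (\<epsilon> * h) \<le> measure (mixture_law \<epsilon> h) {t<..})"
      by blast
  qed
qed

text \<open>
  The number of ranks is at most \<open>log 2 n\<close>, so the left-hand side is at most
  \<open>\<kappa> + ln (ln n) + ln (d/\<alpha>)\<close> for a numerical constant \<open>\<kappa>\<close>. The two variable terms \<open>x\<close> and \<open>y\<close> are bounded
  below by \<open>ln (ln 3) > 0\<close> and by \<open>ln (1/\<eta>) > 0\<close>, so each of \<open>\<kappa>\<close>, \<open>x\<close>, \<open>y\<close> is at most a constant times \<open>x y\<close>.
\<close>

lemma log_level_le_rate:
  assumes "0 < \<eta>" "\<eta> < 1"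
  shows "\<exists>D>0. \<forall>n\<ge>3. \<forall>d\<ge>1. \<forall>\<alpha>\<in>{0<..<1}. \<alpha> / real d \<le> \<eta> \<longrightarrow>
    ln (2 * real d * card (dyadic_ranks n) / \<alpha>) \<le> D * (ln (ln (real n)) * ln (real d / \<alpha>)) \<and>
    1 \<le> D * (ln (ln (real n)) * ln (real d / \<alpha>))"
proof -
  define a\<^sub>0 where "a\<^sub>0 = ln (ln (3 :: real))"
  define b\<^sub>0 where "b\<^sub>0 = ln (1 / \<eta>)"
  \<comment> \<open>There are at most \<open>ln n / ln 2\<close> ranks, whence the constant \<open>2 / ln 2\<close>.\<close>
  define \<kappa> where "\<kappa> = max 1 (ln (2 / ln (2 :: real)))"
  have ln3: "1 < ln (3 :: real)"
    using exp_less_cancel_iff[of 1 "ln (3 :: real)"] e_less_272 by simp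
  have a0: "0 < a\<^sub>0" using ln3 by (simp add: a\<^sub>0_def)
  have b0: "0 < b\<^sub>0" using assms by (simp add: b\<^sub>0_def)
  have \<kappa>: "1 \<le> \<kappa>" "ln (2 / ln 2) \<le> \<kappa>" by (simp_all add: \<kappa>_def)
  define D where "D = \<kappa> / (a\<^sub>0 * b\<^sub>0) + 1 / a\<^sub>0 + 1 / b\<^sub>0"
  have "0 < D" unfolding D_def using a0 b0 \<kappa> by (intro add_pos_pos divide_pos_pos mult_pos_pos) auto
  moreover have "ln (2 * real d * card (dyadic_ranks n) / \<alpha>) \<le> D * (ln (ln (real n)) * ln (real d / \<alpha>)) \<and>
      1 \<le> D * (ln (ln (real n)) * ln (real d / \<alpha>))"
    if n: "3 \<le> n" and d: "1 \<le> d" and \<alpha>: "\<alpha> \<in> {0<..<1}" and \<eta>: "\<alpha> / real d \<le> \<eta>" for n d \<alpha>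
  proof -
    let ?a = "ln (ln (real n))" and ?b = "ln (real d / \<alpha>)"
    have lnn: "ln 3 \<le> ln (real n)" using n by simp
    have a: "a\<^sub>0 \<le> ?a" unfolding a\<^sub>0_def using lnn ln3 by (subst ln_le_cancel_iff) auto
    have "1 / \<eta> \<le> real d / \<alpha>" using \<eta> \<alpha> d assms by (simp add: field_simps)
    then have b: "b\<^sub>0 \<le> ?b" unfolding b\<^sub>0_def using assms \<alpha> d by (subst ln_le_cancel_iff) auto
    have "a\<^sub>0 * b\<^sub>0 \<le> ?a * ?b" using a b a0 b0 by (intro mult_mono) auto
    then have "1 \<le> (?a * ?b) / (a\<^sub>0 * b\<^sub>0)" using a0 b0 by simp
    then have "\<kappa> * 1 \<le> \<kappa> * ((?a * ?b) / (a\<^sub>0 * b\<^sub>0))" using \<kappa> by (intro mult_left_mono) auto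
    moreover have "?b * 1 \<le> ?b * (?a / a\<^sub>0)" using a a0 b b0 by (intro mult_left_mono) auto
    moreover have "?a * 1 \<le> ?a * (?b / b\<^sub>0)" using a a0 b b0 by (intro mult_left_mono) auto
    ultimately have sum: "\<kappa> + ?a + ?b \<le> D * (?a * ?b)"
      unfolding D_def by (simp add: algebra_simps)
    have c: "1 \<le> card (dyadic_ranks n)" using card_dyadic_ranks_pos[of n] n by linarith
    have "2 * real d * card (dyadic_ranks n) / \<alpha> \<le> 2 * real d * log 2 (real n) / \<alpha>"
      using card_dyadic_ranks_le[of n] n \<alpha> by (intro divide_right_mono mult_left_mono) auto
    also have "\<dots> = (2 / ln 2) * ln (real n) * (real d / \<alpha>)" by (simp add: log_def)
    finally have "ln (2 * real d * card (dyadic_ranks n) / \<alpha>) \<le> ln ((2 / ln 2) * ln (real n) * (real d / \<alpha>))"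
      using c d \<alpha> lnn ln3 by (subst ln_le_cancel_iff) (auto intro!: mult_pos_pos divide_pos_pos)
    also have "\<dots> = ln (2 / ln 2) + ?a + ?b"
    proof -
      have "0 < ln (real n)" using lnn ln3 by linarith
      moreover have "0 < real d / \<alpha>" using d \<alpha> by simp
      ultimately have "ln ((2 / ln 2) * ln (real n) * (real d / \<alpha>)) = ln ((2 / ln 2) * ln (real n)) + ?b"
        by (intro ln_mult_pos mult_pos_pos) auto
      also have "ln ((2 / ln 2) * ln (real n)) = ln (2 / ln 2) + ?a"
        using \<open>0 < ln (real n)\<close> by (intro ln_mult_pos) auto
      finally show ?thesis .
    qed
    finally have "ln (2 * real d * card (dyadic_ranks n) / \<alpha>) \<le> \<kappa> + ?a + ?b" using \<kappa> by linarith
    moreover have "1 \<le> \<kappa> + ?a + ?b" using \<kappa> a a0 b b0 by linarith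
    ultimately show ?thesis using sum by linarith
  qed
  ultimately show ?thesis by blast
qed

section \<open>Level and separation rate\<close>

text \<open>
  The constant is chosen so that the gain \<open>c \<rho>\<close> of the mixture tail covers the deviation \<open>r\<close> granted
  under the null hypothesis and the deviation \<open>w\<close> granted under the alternative; these are
  accounted for by the two summands of \<open>C\<close>.
\<close>

theorem Psi3_max_type2_error:
  assumes \<beta>: "0 < \<beta>" "\<beta> < 1" and M: "0 < M" and \<eta>: "0 < \<eta>" "\<eta> < 1"
  shows "\<exists>C>0. \<forall>\<alpha>\<in>{0<..<1}. \<forall>n\<ge>3. \<forall>d\<ge>1. \<forall>\<rho>::real.
       \<alpha> / real d \<le> \<eta> \<longrightarrow>
       8.25 * (ln (4 * real d * log 2 (real n / 2) / \<alpha>) / real n)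
         \<le> (LBINT x:{M..}. std_normal_density x) \<longrightarrow>
       \<rho> \<ge> C * sqrt (ln (ln (real n)) * ln (real d / \<alpha>) / real n) \<longrightarrow>
       max_type2_error n d M \<rho> (Psi3 n d \<alpha>) \<le> ennreal \<beta>"
proof -
  obtain D where D: "0 < D" and
    rate: "\<And>n d \<alpha>. 3 \<le> n \<Longrightarrow> 1 \<le> d \<Longrightarrow> \<alpha> \<in> {0<..<1} \<Longrightarrow> \<alpha> / real d \<le> \<eta> \<Longrightarrow>
      ln (2 * real d * card (dyadic_ranks n) / \<alpha>) \<le> D * (ln (ln (real n)) * ln (real d / \<alpha>)) \<and>
      1 \<le> D * (ln (ln (real n)) * ln (real d / \<alpha>))"
    using log_level_le_rate[OF \<eta>] by blast
  \<comment> \<open>A lower bound for \<open>k/n - r\<close>, since \<open>k/n > 1/4\<close> and \<open>r \<le> sqrt (2/33)\<close> below.\<close>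
  define p\<^sub>0 where "p\<^sub>0 = 1 / 4 - sqrt (2 / 33)"
  have "sqrt (2 / 33) < sqrt ((1 / 4)\<^sup>2)" by (subst real_sqrt_less_iff) (simp add: power2_eq_square)
  then have p0: "0 < p\<^sub>0" by (simp add: p\<^sub>0_def)
  obtain c where c: "0 < c" and
    thresh: "\<And>p. p \<in> {p\<^sub>0..1/2} \<Longrightarrow> \<exists>t. measure std_normal_distribution {t<..} = p \<and>
      (\<forall>\<epsilon>\<in>{0..1}. \<forall>h\<in>{0..M}. p + c * (\<epsilon> * h) \<le> measure (mixture_law \<epsilon> h) {t<..})"
    using ex_separating_threshold[OF p0 _ M, of "1/2"] by auto
  define \<Lambda> where "\<Lambda> = ln (1 / \<beta>)"
  have \<Lambda>: "0 < \<Lambda>" using \<beta> by (simp add: \<Lambda>_def)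
  define C where "C = (sqrt D + sqrt (D * \<Lambda>)) / c"
  have "0 < C" unfolding C_def using D \<Lambda> c by (intro divide_pos_pos add_pos_pos) auto
  moreover have "max_type2_error n d M \<rho> (Psi3 n d \<alpha>) \<le> ennreal \<beta>"
    if \<alpha>: "\<alpha> \<in> {0<..<1}" and n: "3 \<le> n" and d: "1 \<le> d" and \<alpha>\<eta>: "\<alpha> / real d \<le> \<eta>"
      and large: "8.25 * (ln (4 * real d * log 2 (real n / 2) / \<alpha>) / real n)
         \<le> (LBINT x:{M..}. std_normal_density x)"
      and \<rho>: "\<rho> \<ge> C * sqrt (ln (ln (real n)) * ln (real d / \<alpha>) / real n)"
    for \<alpha> \<rho> :: real and n d :: nat
  proof -
    have n2: "2 \<le> n" using n by simp
    define R where "R = ln (ln (real n)) * ln (real d / \<alpha>)"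
    define L where "L = ln (2 * real d * card (dyadic_ranks n) / \<alpha>)"
    define a where "a = \<alpha> / (2 * real d)"
    have a: "0 < a" "a < 1" using \<alpha> d by (auto simp: a_def field_simps)
    have m: "1 \<le> real (card (dyadic_ranks n))" using card_dyadic_ranks_pos[OF n2] by linarith
    have LR: "L \<le> D * R" "1 \<le> D * R"
      using rate[OF n d \<alpha> \<alpha>\<eta>] by (simp_all add: L_def R_def)
    have "1 \<le> real d * card (dyadic_ranks n)"
      using mult_mono[of 1 "real d" 1 "card (dyadic_ranks n)"] d m by simp
    then have "1 \<le> 2 * real d * card (dyadic_ranks n) / \<alpha>" using \<alpha> by (simp add: field_simps)
    then have L0: "0 \<le> L" unfolding L_def by (rule ln_ge_zero)
    \<comment> \<open>\<open>L\<close> is the logarithm of the inverse Bonferroni level, so \<open>r\<close> below meets that level exactly.\<close>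
    have expL: "exp (- L) = a / card (dyadic_ranks n)"
      using \<alpha> d m by (simp add: L_def a_def exp_minus field_simps)
    have "2 * real d * card (dyadic_ranks n) / \<alpha> \<le> 4 * real d * log 2 (real n / 2) / \<alpha>"
      using card_dyadic_ranks_le_twice_log[OF n] \<alpha> d by (intro divide_right_mono) (auto simp: field_simps)
    then have "L \<le> ln (4 * real d * log 2 (real n / 2) / \<alpha>)"
      unfolding L_def using \<open>1 \<le> 2 * real d * card (dyadic_ranks n) / \<alpha>\<close> by (subst ln_le_cancel_iff) linarith+
    then have "8.25 * (L / real n) \<le> 8.25 * (ln (4 * real d * log 2 (real n / 2) / \<alpha>) / real n)"
      by (intro mult_left_mono divide_right_mono) auto
    also have "\<dots> \<le> 1" using large std_normal_tail_integral_le_1[of M] by linarith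
    \<comment> \<open>\<open>2/33 = 1 / (2 * 8.25)\<close>, and \<open>32 < 33\<close> makes \<open>p\<^sub>0\<close> positive.\<close>
    finally have Ln: "L / (2 * real n) \<le> 2 / 33" using n by (simp add: field_simps)

    obtain k where k: "k \<in> dyadic_ranks n" and kn: "n < 4 * k"
      by (rule ex_large_dyadic_rank[OF n2])
    define r where "r = sqrt (L / (2 * real n))"
    define w where "w = sqrt (\<Lambda> / (2 * real n))"
    have rw: "0 \<le> r" "0 \<le> w" using L0 \<Lambda> by (simp_all add: r_def w_def)
    have expr: "exp (- 2 * real n * r\<^sup>2) \<le> a / card (dyadic_ranks n)"
      using L0 n by (simp add: r_def flip: expL)
    have expw: "exp (- 2 * real n * w\<^sup>2) \<le> \<beta>"
      using \<Lambda> n \<beta> by (simp add: w_def) (simp add: \<Lambda>_def ln_div)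
    have r_le: "r \<le> sqrt (2 / 33)" unfolding r_def using Ln by (rule real_sqrt_le_mono)
    define p where "p = real k / real n - r"
    have "1 / 4 \<le> real k / real n" "real k / real n \<le> 1 / 2"
      using kn dyadic_ranks_bounds[OF n2 k] n by (simp_all add: field_simps)
    then have "p \<in> {p\<^sub>0..1/2}"
      using r_le rw unfolding p_def p\<^sub>0_def atLeastAtMost_iff by linarith
    from thresh[OF this] obtain t where t: "measure std_normal_distribution {t<..} = p"
      and gain: "\<And>\<epsilon> h. \<epsilon> \<in> {0..1} \<Longrightarrow> h \<in> {0..M} \<Longrightarrow> p + c * (\<epsilon> * h) \<le> measure (mixture_law \<epsilon> h) {t<..}"
      by blast
    have rw_le: "r + w \<le> c * \<rho>"
    proof -
      have cC: "c * C = sqrt D + sqrt (D * \<Lambda>)" using c by (simp add: C_def)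
      have "L / (2 * real n) \<le> D * (R / real n)"
        using LR L0 n by (simp add: field_simps)
      then have "r \<le> sqrt D * sqrt (R / real n)"
        unfolding r_def real_sqrt_mult[symmetric] by (rule real_sqrt_le_mono)
      \<comment> \<open>The deviation \<open>w\<close> is of order \<open>1 / sqrt n\<close>; \<open>1 \<le> D * R\<close> brings it to the rate.\<close>
      moreover have "\<Lambda> * 1 \<le> \<Lambda> * (2 * (D * R))" using LR \<Lambda> by (intro mult_left_mono) auto
      then have "\<Lambda> / (2 * real n) \<le> (D * \<Lambda>) * (R / real n)"
        using n by (simp add: field_simps)
      then have "w \<le> sqrt (D * \<Lambda>) * sqrt (R / real n)"
        unfolding w_def real_sqrt_mult[symmetric] by (rule real_sqrt_le_mono)
      ultimately have "r + w \<le> c * (C * sqrt (R / real n))"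
        using cC by (simp add: mult.assoc[symmetric] distrib_right)
      also have "\<dots> \<le> c * \<rho>" using \<rho> c unfolding R_def by (intro mult_left_mono) auto
      finally show ?thesis .
    qed
    show ?thesis unfolding max_type2_error_def
    proof (intro SUP_least, clarify)
      fix \<epsilon> \<mu> assume params: "(\<epsilon>, \<mu>) \<in> mixture_params d M" and sep: "\<rho> \<le> \<epsilon> * linf_norm d \<mu>"
      have \<epsilon>: "0 \<le> \<epsilon>" "\<epsilon> \<le> 1" and "linf_norm d \<mu> \<le> M"
        using params by (auto simp: mixture_params_def)
      have "linf_norm d \<mu> \<in> (\<lambda>j. \<bar>\<mu> j\<bar>) ` {1..d}"
        unfolding linf_norm_def by (rule Max_in) (use d in auto)
      then obtain j where j: "j \<in> {1..d}" and norm: "linf_norm d \<mu> = \<bar>\<mu> j\<bar>" by blast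
      \<comment> \<open>The sign that turns the shift of coordinate \<open>j\<close> into \<open>\<bar>\<mu> j\<bar>\<close>.\<close>
      define s :: real where "s = (if \<mu> j < 0 then -1 else 1)"
      have s: "s \<in> {1, -1}" and sj: "s * \<mu> j = \<bar>\<mu> j\<bar>" by (auto simp: s_def)
      let ?S = "sample_law n d (mixture_density d \<epsilon> \<mu>)"
      interpret S: prob_space ?S
        unfolding sample_law_mixture by (intro prob_space_PiM prob_space_mixture_vector_law d \<epsilon>)
      have "c * \<rho> \<le> c * (\<epsilon> * \<bar>\<mu> j\<bar>)" using sep c by (simp add: norm)
      moreover have "p + c * (\<epsilon> * \<bar>\<mu> j\<bar>) \<le> measure (mixture_law \<epsilon> \<bar>\<mu> j\<bar>) {t<..}"
        using \<epsilon> \<open>linf_norm d \<mu> \<le> M\<close> by (intro gain) (auto simp: norm)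
      ultimately have power: "real k / real n + w \<le> measure (mixture_law \<epsilon> \<bar>\<mu> j\<bar>) {t<..}"
        using rw_le unfolding p_def by linarith
      have "\<P>(x in ?S. Psi3 n d \<alpha> x = 0) \<le> \<P>(x in ?S. T_plus n a (\<lambda>i. s * x i j) = 0)"
      proof (rule S.finite_measure_mono)
        note measurable_T_plus_coordinate[OF n2 j sets_sample_law, measurable]
        show "{x \<in> space ?S. T_plus n a (\<lambda>i. s * x i j) = 0} \<in> S.events" by measurable
        show "{x \<in> space ?S. Psi3 n d \<alpha> x = 0} \<subseteq> {x \<in> space ?S. T_plus n a (\<lambda>i. s * x i j) = 0}"
        proof safe
          fix x assume "Psi3 n d \<alpha> x = 0"
          then have "T_plus n a (\<lambda>i. s * x i j) \<noteq> 1"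
            using j s unfolding Psi3_eq[OF n2 d] a_def by fastforce
          then show "T_plus n a (\<lambda>i. s * x i j) = 0"
            by (simp only: T_plus_eq[OF n2] of_bool_eq_1_iff of_bool_eq_0_iff not_False_eq_True)
        qed
      qed
      also have "\<dots> = \<P>(z in \<Pi>\<^sub>M i\<in>{1..n}. mixture_law \<epsilon> \<bar>\<mu> j\<bar>. T_plus n a z = 0)"
        unfolding prob_T_plus_coordinate[OF n2 j s \<epsilon>] sj ..
      also have "\<dots> \<le> \<beta>"
        by (rule T_plus_type2_error[OF n2 a k \<epsilon> rw expr expw _ power]) (simp add: t p_def)
      finally show "ennreal \<P>(x in ?S. Psi3 n d \<alpha> x = 0) \<le> ennreal \<beta>" by (rule ennreal_leI)
    qed
  qed
  ultimately show ?thesis by blast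
qed

theorem theorem6:
  fixes \<beta> M :: real
  assumes "0 < \<beta>" "\<beta> < 1" and "0 < M"
  shows "(\<forall>\<alpha>\<in>{0<..<1}. \<forall>n\<ge>2. \<forall>d\<ge>1. test_of_level n d (Psi3 n d \<alpha>) \<alpha>) \<and>
    (\<forall>\<eta>\<in>{0<..<1}. \<exists>C>0. \<forall>\<alpha>\<in>{0<..<1}. \<forall>n\<ge>3. \<forall>d\<ge>1. \<forall>\<rho>::real.
       \<alpha> / real d \<le> \<eta> \<longrightarrow>
       8.25 * (ln (4 * real d * log 2 (real n / 2) / \<alpha>) / real n)
         \<le> (LBINT x:{M..}. std_normal_density x) \<longrightarrow>
       \<rho> \<ge> C * sqrt (ln (ln (real n)) * ln (real d / \<alpha>) / real n) \<longrightarrow>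
       max_type2_error n d M \<rho> (Psi3 n d \<alpha>) \<le> ennreal \<beta>)"
proof (intro conjI ballI allI impI)
  show "test_of_level n d (Psi3 n d \<alpha>) \<alpha>" if "\<alpha> \<in> {0<..<1}" "2 \<le> n" "1 \<le> d" for \<alpha> n d
    using that by (intro Psi3_level) auto
next
  fix \<eta> :: real assume "\<eta> \<in> {0<..<1}"
  then have "0 < \<eta>" "\<eta> < 1" by auto
  from Psi3_max_type2_error[OF assms this]
  show "\<exists>C>0. \<forall>\<alpha>\<in>{0<..<1}. \<forall>n\<ge>3. \<forall>d\<ge>1. \<forall>\<rho>::real.
       \<alpha> / real d \<le> \<eta> \<longrightarrow>
       8.25 * (ln (4 * real d * log 2 (real n / 2) / \<alpha>) / real n)
         \<le> (LBINT x:{M..}. std_normal_density x) \<longrightarrow>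
       \<rho> \<ge> C * sqrt (ln (ln (real n)) * ln (real d / \<alpha>) / real n) \<longrightarrow>
       max_type2_error n d M \<rho> (Psi3 n d \<alpha>) \<le> ennreal \<beta>" .
qed

end
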